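(* \begin{enumerate} \item For every $n\ge 3$, $\mathrm{ex}_{b,c}(n,P_5)=\mathrm{ex}_{b,c}(n,P_6)=2n-1$. \item $\mathrm{ex}_{b,c}(n,D_{2,2})=4n-9$ for all $n\ge 6$, and $\mathrm{ex}_{b,c}(n,D_{2,2})=\mathrm{ex}_b(n,D_{2,2})$ for $3\le n\le 5$. \item For every $n\ge 4$, $\mathrm{ex}_{b,c}(n,S_{3,1,1})=2n$. \item For every $n\ge 3$, $\mathrm{ex}_{b,c}(n,S_{2,2,1})=2n$. \end{enumerate}
   Context: All graphs are finite and simple. A graph is $F$-free if it has no (not necessarily induced) subgraph isomorphic to $F$. $\mathrm{ex}_b(n,F)$ is the largest number of edges of an $F$-free bipartite graph with both parts of size $n$; $\mathrm{ex}_{b,c}(n,F)$ is the largest number of edges of an $F$-free connected bipartite graph with both parts of size $n$. $P_k$ is the path on $k$ vertices. The spider $S_{a_1,\dots,a_j}$ is obtained from $j$ paths with $a_1,\dots,a_j$ edges by identifying one endpoint of all the paths. The double star $D_{a,b}$ is the tree on $a+b+2$ vertices consisting of an edge $uv$ together with $a$ leaves attached to $u$ and $b$ leaves attached to $v$. *)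

theory Defs
  imports Main
begin

type_synonym 'a graph = "'a set \<times> 'a set set"

abbreviation verts :: "'a graph \<Rightarrow> 'a set" where "verts G \<equiv> fst G"
abbreviation edges :: "'a graph \<Rightarrow> 'a set set" where "edges G \<equiv> snd G"

definition simple_graph :: "'a graph \<Rightarrow> bool" where
  "simple_graph G \<longleftrightarrow> finite (verts G) \<and> (\<forall>e\<in>edges G. e \<subseteq> verts G \<and> card e = 2)"

definition adj_rel :: "'a graph \<Rightarrow> ('a \<times> 'a) set" where
  "adj_rel G = {(u, v). {u, v} \<in> edges G}"

definition connected_graph :: "'a graph \<Rightarrow> bool" where
  "connected_graph G \<longleftrightarrow>
     verts G \<noteq> {} \<and> (\<forall>u\<in>verts G. \<forall>v\<in>verts G. (u, v) \<in> (adj_rel G)\<^sup>*)"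

definition bipartition :: "'a graph \<Rightarrow> 'a set \<Rightarrow> 'a set \<Rightarrow> bool" where
  "bipartition G A B \<longleftrightarrow>
     A \<union> B = verts G \<and> A \<inter> B = {} \<and> (\<forall>e\<in>edges G. \<exists>a\<in>A. \<exists>b\<in>B. e = {a, b})"

definition balanced_bipartite :: "nat \<Rightarrow> 'a graph \<Rightarrow> bool" where
  "balanced_bipartite n G \<longleftrightarrow>
     simple_graph G \<and>
     (\<exists>A B. bipartition G A B \<and> finite A \<and> card A = n \<and> finite B \<and> card B = n)"

definition subgraph :: "'a graph \<Rightarrow> 'a graph \<Rightarrow> bool" where
  "subgraph H G \<longleftrightarrow> simple_graph H \<and> verts H \<subseteq> verts G \<and> edges H \<subseteq> edges G"

definition graph_iso :: "'a graph \<Rightarrow> 'b graph \<Rightarrow> bool" where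
  "graph_iso F H \<longleftrightarrow>
     (\<exists>f. bij_betw f (verts F) (verts H) \<and> edges H = (\<lambda>e. f ` e) ` edges F)"

definition graph_free :: "'a graph \<Rightarrow> 'b graph \<Rightarrow> bool" where
  "graph_free F G \<longleftrightarrow> \<not> (\<exists>H. subgraph H G \<and> graph_iso F H)"

(* Every finite graph is isomorphic to one whose vertices are natural numbers,
   so it suffices to range over those. *)
definition ex_b :: "nat \<Rightarrow> 'a graph \<Rightarrow> nat" where
  "ex_b n F = Max {card (edges G) | G :: nat graph. balanced_bipartite n G \<and> graph_free F G}"

definition ex_bc :: "nat \<Rightarrow> 'a graph \<Rightarrow> nat" where
  "ex_bc n F = Max {card (edges G) | G :: nat graph.
     balanced_bipartite n G \<and> connected_graph G \<and> graph_free F G}"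

definition path_graph :: "nat \<Rightarrow> nat graph" where
  "path_graph k = ({..<k}, {{i, Suc i} | i. Suc i < k})"

(* Vertex d of leg i is Some (i, d) for d > 0; the vertices with d = 0, one per leg,
   are all identified with the centre None. *)
definition spider_vertex :: "nat \<Rightarrow> nat \<Rightarrow> (nat \<times> nat) option" where
  "spider_vertex i d = (if d = 0 then None else Some (i, d))"

definition spider :: "nat list \<Rightarrow> (nat \<times> nat) option graph" where
  "spider as =
     ({spider_vertex i d | i d. i < length as \<and> d \<le> as ! i},
      {{spider_vertex i d, spider_vertex i (Suc d)} | i d. i < length as \<and> d < as ! i})"

datatype double_star_vertex = CentreU | CentreV | LeafU nat | LeafV nat

definition double_star :: "nat \<Rightarrow> nat \<Rightarrow> double_star_vertex graph" where
  "double_star a b =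
     ({CentreU, CentreV} \<union> LeafU ` {..<a} \<union> LeafV ` {..<b},
      {{CentreU, CentreV}} \<union> {{CentreU, LeafU i} | i. i < a} \<union> {{CentreV, LeafV i} | i. i < b})"

(* The sets maximised over in ex_b and ex_bc are finite. *)

lemma card_edges_le:
  assumes "balanced_bipartite n G"
  shows "card (edges G) \<le> 2 ^ (2 * n)"
proof -
  from assms obtain A B where
    "simple_graph G" "bipartition G A B" "finite A" "card A = n" "finite B" "card B = n"
    unfolding balanced_bipartite_def by blast
  then have fin: "finite (verts G)" and sub: "edges G \<subseteq> Pow (verts G)"
    and "card (verts G) = 2 * n"
    by (auto simp: simple_graph_def bipartition_def card_Un_disjoint
        dest: sym[of "A \<union> B" "verts G"])
  then show ?thesis
    using card_mono[OF _ sub] by (simp add: card_Pow)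
qed

lemma finite_ex_b_set:
  "finite {card (edges G) | G :: nat graph. balanced_bipartite n G \<and> graph_free F G}"
  by (rule finite_subset[of _ "{..2 ^ (2 * n)}"]) (use card_edges_le in auto)

lemma finite_ex_bc_set:
  "finite {card (edges G) | G :: nat graph.
     balanced_bipartite n G \<and> connected_graph G \<and> graph_free F G}"
  by (rule finite_subset[of _ "{..2 ^ (2 * n)}"]) (use card_edges_le in auto)

end

theory Submission
  imports Defs
begin

text \<open>
  \<^item> \<open>P\<^sub>6\<close>: a 4-cycle in a connected graph with at least three vertices per side extends to
    a \<open>P\<^sub>6\<close>. Without 4-cycles, all vertices of one side except one are leaves, whence at most
    \<open>2n - 1\<close> edges. The double star \<open>D\<^bsub>n-1,n-1\<^esub>\<close> has that many and no \<open>P\<^sub>5\<close>.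
  \<^item> \<open>D\<^bsub>2,2\<^esub>\<close>: freeness means that no two vertices of degree at least 3 (big ones) are adjacent.
    With at most one big vertex on some side there are at most \<open>max (2n) (3n - 3)\<close> edges. With at
    least two on each side, every edge has a small end, so there are at most \<open>4(n - 2)\<close> edges,
    and connectedness forces an edge with two small ends, which this bound counts twice. For
    \<open>3 \<le> n \<le> 5\<close> the optimum \<open>3n - 3\<close> is attained by a connected graph.
  \<^item> \<open>S\<^bsub>3,1,1\<^esub>\<close>: the neighbourhood of a vertex of degree 3 is the whole other side, which excludes
    \<open>n \<ge> 4\<close>. If the degree is larger, the other vertices of its side are leaves.
  \<^item> \<open>S\<^bsub>2,2,1\<^esub>\<close>: a vertex of degree at least 3 has at most one neighbour that is not a leaf.
    So each vertex can pass its degree in excess of 2 to its leaves, and the average degree is at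
    most 2.
  \<^item> The cycle on \<open>2n\<close> vertices contains no spider with three legs.
\<close>

section \<open>Bipartite graphs as relations\<close>

text \<open>Every edge is a pair pointing from \<open>A\<close> to \<open>B\<close>, and the two
  sides may even have different types. A statement about \<open>B\<close> is the statement about
  \<open>A\<close> applied to \<open>R\<inverse>\<close>.\<close>

locale bip =
  fixes A :: "'a set" and B :: "'b set" and R :: "('a \<times> 'b) set"
  assumes finA: "finite A" and finB: "finite B" and RAB: "R \<subseteq> A \<times> B"
begin

lemma bip_converse: "bip B A (R\<inverse>)"
  using finA finB RAB by unfold_locales auto

lemma finite_R [simp]: "finite R"
  using finite_subset[OF RAB] finA finB by blast

lemma Image_subset: "R `` X \<subseteq> B"
  using RAB by blast

lemma finite_Image [simp]: "finite (R `` X)"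
  using finite_subset[OF Image_subset finB] .

lemma card_Int_Times:
  assumes "X \<subseteq> A"
  shows "card (R \<inter> X \<times> UNIV) = (\<Sum>a\<in>X. card (R `` {a}))"
proof -
  have "R \<inter> X \<times> UNIV = Sigma X (\<lambda>a. R `` {a})"
    by auto
  then show ?thesis
    using finite_subset[OF assms finA] by simp
qed

lemma card_R: "card R = (\<Sum>a\<in>A. card (R `` {a}))"
proof -
  have "R \<inter> A \<times> UNIV = R"
    using RAB by auto
  then show ?thesis
    using card_Int_Times[of A] by simp
qed

lemma card_Int_Times_le:
  assumes "X \<subseteq> A" "\<And>a. a \<in> X \<Longrightarrow> card (R `` {a}) \<le> k"
  shows "card (R \<inter> X \<times> UNIV) \<le> k * card X"
  using sum_bounded_above[of X "\<lambda>a. card (R `` {a})" k] assms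
  by (simp add: card_Int_Times mult.commute)

lemma card_R_le_all:
  assumes "\<And>a. a \<in> A \<Longrightarrow> card (R `` {a}) \<le> k"
  shows "card R \<le> k * card A"
  using sum_bounded_above[of A "\<lambda>a. card (R `` {a})" k] assms
  by (simp add: card_R mult.commute)

lemma card_R_le_all_but_one:
  assumes "x \<in> A" "card (R `` {x}) \<le> d"
    and "\<And>a. a \<in> A \<Longrightarrow> a \<noteq> x \<Longrightarrow> card (R `` {a}) \<le> k"
  shows "card R \<le> d + k * (card A - 1)"
proof -
  have "card R = card (R `` {x}) + (\<Sum>a\<in>A - {x}. card (R `` {a}))"
    using assms(1) finA by (simp add: card_R sum.remove)
  moreover have "(\<Sum>a\<in>A - {x}. card (R `` {a})) \<le> card (A - {x}) * k"
    using sum_bounded_above[of "A - {x}" "\<lambda>a. card (R `` {a})" k] assms(3) by simp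
  ultimately show ?thesis
    using assms(1,2) by (simp add: mult.commute)
qed

lemma card_Image_le: "card (R `` X) \<le> card B"
  using Image_subset finB by (rule card_mono[rotated])

text \<open>The exceptional vertex has at most \<open>card B\<close> edges, each of the other
  \<open>card A - 1\<close> at most one.\<close>

lemma card_R_le_star:
  assumes "x \<in> A" "\<And>a. a \<in> A \<Longrightarrow> a \<noteq> x \<Longrightarrow> card (R `` {a}) \<le> 1"
  shows "card R \<le> card A + card B - 1"
proof -
  have "card A > 0"
    using assms(1) finA card_gt_0_iff by blast
  then show ?thesis
    using card_R_le_all_but_one[OF assms(1) card_Image_le[of "{x}"] assms(2)] by simp
qed

end

text \<open>Connectedness through closed sets: a nonempty set of vertices that contains all its
  neighbours, with sides \<open>S\<close> and \<open>T\<close>, is the whole graph. The bounds below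
  choose \<open>S\<close> and \<open>T\<close> to suit the forbidden graph.\<close>

locale conn_bip = bip +
  assumes closed_all: "\<And>S T. S \<subseteq> A \<Longrightarrow> T \<subseteq> B \<Longrightarrow> R `` S \<subseteq> T \<Longrightarrow> R\<inverse> `` T \<subseteq> S \<Longrightarrow>
    S \<noteq> {} \<or> T \<noteq> {} \<Longrightarrow> S = A \<and> T = B"
begin

lemma conn_bip_converse: "conn_bip B A (R\<inverse>)"
  using bip_converse closed_all
  unfolding conn_bip_def conn_bip_axioms_def converse_converse by metis

end

lemma ex_not_mem:
  assumes "finite Y" "card Y < card X"
  shows "\<exists>x\<in>X. x \<notin> Y"
  using assms by (meson card_mono linorder_not_le subsetI)

lemma ex_not_in_list:
  assumes "length ys < card X"
  shows "\<exists>x\<in>X. x \<notin> set ys"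
  using assms card_length[of ys] by (intro ex_not_mem) auto

lemma card_le_1_if_subset_singleton: "X \<subseteq> {x} \<Longrightarrow> card X \<le> 1"
  using card_mono[of "{x}" X] by simp

lemma card_ge_2_cases:
  assumes "finite X"
  obtains "X = {}" | x where "X = {x}" | "card X \<ge> 2"
proof -
  consider "card X = 0" | "card X = 1" | "card X \<ge> 2"
    by linarith
  then show ?thesis
    by cases (use assms that in \<open>auto simp: card_1_singleton_iff\<close>)
qed

section \<open>Paths on six vertices\<close>

text \<open>Six vertices alternate between the sides, so the path has one end on each side and can
  be read from its end in \<open>A\<close>. Distinctness is required within each side only, because
  the sides will be disjoint.\<close>

definition has_path6 :: "('a \<times> 'b) set \<Rightarrow> bool" where
  "has_path6 R \<longleftrightarrow> (\<exists>a1 a2 a3 b1 b2 b3. distinct [a1, a2, a3] \<and> distinct [b1, b2, b3] \<and>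
     {(a1, b1), (a2, b1), (a2, b2), (a3, b2), (a3, b3)} \<subseteq> R)"

lemma has_path6I:
  assumes "(a1, b1) \<in> R" "(a2, b1) \<in> R" "(a2, b2) \<in> R" "(a3, b2) \<in> R" "(a3, b3) \<in> R"
    and "a1 \<noteq> a2" "a1 \<noteq> a3" "a2 \<noteq> a3" "b1 \<noteq> b2" "b1 \<noteq> b3" "b2 \<noteq> b3"
  shows "has_path6 R"
  unfolding has_path6_def
  by (rule exI[of _ a1], rule exI[of _ a2], rule exI[of _ a3],
      rule exI[of _ b1], rule exI[of _ b2], rule exI[of _ b3]) (use assms in auto)

lemma has_path6_converse:
  assumes "has_path6 (R\<inverse>)"
  shows "has_path6 R"
proof -
  obtain a1 a2 a3 b1 b2 b3 where "distinct [a1, a2, a3]" "distinct [b1, b2, b3]"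
    "{(a1, b1), (a2, b1), (a2, b2), (a3, b2), (a3, b3)} \<subseteq> R\<inverse>"
    using assms unfolding has_path6_def by (elim exE conjE) (rule that)
  then show ?thesis
    by (intro has_path6I[of b3 a3 R b2 a2 b1 a1]) auto
qed

context conn_bip
begin

text \<open>The path enters the cycle from \<open>a3\<close>, runs through all four of its vertices
  and leaves it towards a vertex outside \<open>{b1, b2}\<close> that connectedness
  supplies.\<close>

lemma four_cycle_extension_has_path6:
  assumes cyc: "(a1, b1) \<in> R" "(a1, b2) \<in> R" "(a2, b1) \<in> R" "(a2, b2) \<in> R" "a1 \<noteq> a2" "b1 \<noteq> b2"
    and a3: "a3 \<in> R\<inverse> `` {b1, b2}" "a3 \<noteq> a1" "a3 \<noteq> a2" and B: "card B \<ge> 3"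
  shows "has_path6 R"
proof -
  \<comment> \<open>Otherwise \<open>{b1, b2}\<close> and its neighbours are closed, and
    \<open>B\<close> has only two vertices.\<close>
  have "\<not> R `` (R\<inverse> `` {b1, b2}) \<subseteq> {b1, b2}"
  proof
    assume "R `` (R\<inverse> `` {b1, b2}) \<subseteq> {b1, b2}"
    then have "{b1, b2} = B"
      using closed_all[of "R\<inverse> `` {b1, b2}" "{b1, b2}"] RAB cyc by auto
    then show False
      using B by (auto simp: card_insert_if split: if_splits)
  qed
  then obtain x b3 where x: "(x, b1) \<in> R \<or> (x, b2) \<in> R" "(x, b3) \<in> R" "b3 \<noteq> b1" "b3 \<noteq> b2"
    by auto
  have a3': "(a3, b1) \<in> R \<or> (a3, b2) \<in> R"
    using a3(1) by blast
  consider "x = a1" | "x = a2" | "x \<noteq> a1" "x \<noteq> a2" by blast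
  then show ?thesis
  proof cases
    case 1
    then have "(a1, b3) \<in> R" using x(2) by simp
    then show ?thesis
      using a3' has_path6I[of a3 b1 R a2 b2 a1 b3] has_path6I[of a3 b2 R a2 b1 a1 b3]
        a3(2,3) x(3,4) cyc by metis
  next
    case 2
    then have "(a2, b3) \<in> R" using x(2) by simp
    then show ?thesis
      using a3' has_path6I[of a3 b1 R a1 b2 a2 b3] has_path6I[of a3 b2 R a1 b1 a2 b3]
        a3(2,3) x(3,4) cyc by metis
  next
    \<comment> \<open>Here \<open>x\<close> is a vertex off the cycle, so the path starts on the
      cycle and ends with \<open>x\<close>, \<open>b3\<close>.\<close>
    case 3
    then show ?thesis
      using x cyc has_path6I[of a2 b2 R a1 b1 x b3] has_path6I[of a2 b1 R a1 b2 x b3] by metis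
  qed
qed

text \<open>A 4-cycle without outside neighbours would be the whole graph. An outside neighbour lies
  in \<open>A\<close> or in \<open>B\<close>, and the second case is the first one for the converse
  relation.\<close>

lemma four_cycle_has_path6:
  assumes cyc: "(a1, b1) \<in> R" "(a1, b2) \<in> R" "(a2, b1) \<in> R" "(a2, b2) \<in> R" "a1 \<noteq> a2" "b1 \<noteq> b2"
    and A: "card A \<ge> 3" and B: "card B \<ge> 3"
  shows "has_path6 R"
proof -
  have "\<not> (R\<inverse> `` {b1, b2} \<subseteq> {a1, a2} \<and> R `` {a1, a2} \<subseteq> {b1, b2})"
  proof
    assume "R\<inverse> `` {b1, b2} \<subseteq> {a1, a2} \<and> R `` {a1, a2} \<subseteq> {b1, b2}"
    then have "{a1, a2} = A"
      using closed_all[of "{a1, a2}" "{b1, b2}"] RAB cyc by auto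
    then show False
      using A by (auto simp: card_insert_if split: if_splits)
  qed
  then consider a3 where "a3 \<in> R\<inverse> `` {b1, b2}" "a3 \<noteq> a1" "a3 \<noteq> a2"
    | b3 where "b3 \<in> R `` {a1, a2}" "b3 \<noteq> b1" "b3 \<noteq> b2"
    by blast
  then show ?thesis
  proof cases
    case 1
    then show ?thesis
      using four_cycle_extension_has_path6 cyc B by blast
  next
    case 2
    then have "has_path6 (R\<inverse>)"
      using conn_bip.four_cycle_extension_has_path6[OF conn_bip_converse, of b1 a1 a2 b2 b3] cyc A
      by auto
    then show ?thesis
      by (rule has_path6_converse)
  qed
qed

lemma ex_other_neighbour:
  assumes "card (R `` {a}) > 1"
  obtains b' where "(a, b') \<in> R" "b' \<noteq> b"
  using ex_not_in_list[of "[b]" "R `` {a}"] assms by auto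

text \<open>If two non-leaves of \<open>A\<close> share a neighbour \<open>b\<close>, then all of
  \<open>B\<close> except \<open>b\<close> consists of leaves. Otherwise a non-leaf \<open>a\<close>
  of \<open>A\<close>, if there is one, has only leaves beside it in \<open>A\<close>.\<close>

lemma path6_free_card_le:
  assumes no6: "\<not> has_path6 R" and A: "card A \<ge> 3" and B: "card B \<ge> 3"
  shows "card R \<le> card A + card B - 1"
proof (cases "\<exists>a a2 b. card (R `` {a}) > 1 \<and> card (R `` {a2}) > 1 \<and> a \<noteq> a2 \<and> (a, b) \<in> R \<and> (a2, b) \<in> R")
  case True
  then obtain a a2 b where *: "card (R `` {a}) > 1" "card (R `` {a2}) > 1" "a \<noteq> a2" "(a, b) \<in> R" "(a2, b) \<in> R"
    by blast
  \<comment> \<open>The path to be excluded is \<open>x\<close>, \<open>c\<close>,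
    \<open>a'\<close>, \<open>b\<close>, \<open>a''\<close>, \<open>d\<close>.\<close>
  have leaf: "x = a'" if "(a', b) \<in> R" "(a', c) \<in> R" "c \<noteq> b" "(x, c) \<in> R" for a' c x
  proof (rule ccontr)
    assume "x \<noteq> a'"
    \<comment> \<open>Of the two non-leaves \<open>a\<close> and \<open>a2\<close> at
      \<open>b\<close>, at least one differs from \<open>a'\<close>.\<close>
    obtain a'' where a'': "a'' \<noteq> a'" "(a'', b) \<in> R" "card (R `` {a''}) > 1"
      using * by metis
    obtain d where d: "(a'', d) \<in> R" "d \<noteq> b"
      using ex_other_neighbour[OF a''(3)] .
    \<comment> \<open>This coincidence, like \<open>x = a''\<close> below, would close a 4-cycle on
      \<open>a'\<close>, \<open>b\<close>, \<open>a''\<close>, \<open>c\<close>.\<close>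
    have "d \<noteq> c"
      using four_cycle_has_path6[of a' b c a''] a'' d that no6 A B by auto
    moreover have "x \<noteq> a''"
      using four_cycle_has_path6[of a' b c a''] a'' \<open>x \<noteq> a'\<close> that no6 A B by auto
    ultimately have "has_path6 R"
      using that a'' d \<open>x \<noteq> a'\<close> by (intro has_path6I[of x c _ a' b a'' d]) auto
    with no6 show False ..
  qed
  \<comment> \<open>By \<open>leaf\<close>, no edge leaves the set of vertices within distance two
    of \<open>b\<close>.\<close>
  have "R\<inverse> `` {b} = A \<and> R `` (R\<inverse> `` {b}) = B"
    using RAB *(4) leaf by (intro closed_all) auto
  then have "card (R\<inverse> `` {c}) \<le> 1" if "c \<in> B" "c \<noteq> b" for c
  proof -
    have "c \<in> R `` (R\<inverse> `` {b})"
      using that \<open>R\<inverse> `` {b} = A \<and> R `` (R\<inverse> `` {b}) = B\<close> by blast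
    then obtain a' where "(a', b) \<in> R" "(a', c) \<in> R"
      by blast
    then have "R\<inverse> `` {c} \<subseteq> {a'}"
      using leaf that(2) by auto
    then show ?thesis
      by (rule card_le_1_if_subset_singleton)
  qed
  moreover have "b \<in> B"
    using * RAB by auto
  ultimately show ?thesis
    using bip.card_R_le_star[OF bip_converse, of b] by simp
next
  case False
  show ?thesis
  proof (cases "\<exists>a\<in>A. card (R `` {a}) > 1")
    case True
    then obtain a where a: "a \<in> A" "card (R `` {a}) > 1"
      by blast
    \<comment> \<open>\<open>x\<close> shares the neighbour \<open>b\<close> with the non-leaf
      \<open>a\<close>, so in this case \<open>x\<close> is a leaf.\<close>
    have leaf: "c = b" if "(a, b) \<in> R" "(x, b) \<in> R" "x \<noteq> a" "(x, c) \<in> R" for b c x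
    proof -
      have "card (R `` {x}) \<le> 1"
        using False a that by (meson not_le)
      then show ?thesis
        using that by (auto simp: card_le_Suc0_iff_eq)
    qed
    have "R `` (R\<inverse> `` (R `` {a})) \<subseteq> R `` {a}"
      using leaf by blast
    moreover have "R `` {a} \<noteq> {}"
      using a by auto
    ultimately have "R\<inverse> `` (R `` {a}) = A"
      using closed_all[of "R\<inverse> `` (R `` {a})" "R `` {a}"] RAB by blast
    then have "\<exists>b. R `` {x} \<subseteq> {b}" if "x \<in> A" "x \<noteq> a" for x
      using leaf that by blast
    then have "card (R `` {x}) \<le> 1" if "x \<in> A" "x \<noteq> a" for x
      using that by (metis card_le_1_if_subset_singleton)
    then show ?thesis
      using card_R_le_star a(1) by blast
  next
    case False
    then have "card R \<le> 1 * card A"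
      by (intro card_R_le_all) auto
    then show ?thesis
      using B by linarith
  qed
qed

end

section \<open>Double stars\<close>

context bip
begin

definition big :: "'a set" where
  "big = {a \<in> A. card (R `` {a}) \<ge> 3}"

lemma finite_big: "finite big"
  using finA by (simp add: big_def)

lemma big_subset: "big \<subseteq> A"
  by (auto simp: big_def)

lemma big_emptyD: "big = {} \<Longrightarrow> card R \<le> 2 * card A"
  by (intro card_R_le_all) (force simp: big_def)

text \<open>\<open>Y\<close> is going to be the set of big vertices of the other side. The vertex
  \<open>x\<close> misses at least one of them, and the other vertices of \<open>A\<close> are
  small.\<close>

lemma card_le_if_one_big:
  assumes "big = {x}" "Y \<subseteq> B" "Y \<noteq> {}" "\<And>y. y \<in> Y \<Longrightarrow> (x, y) \<notin> R"
  shows "card R \<le> card B - 1 + 2 * (card A - 1)"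
proof (rule card_R_le_all_but_one)
  obtain y where y: "y \<in> Y" using assms(3) by blast
  then have "R `` {x} \<subseteq> B - {y}"
    using assms(4)[OF y] RAB by blast
  moreover have "card (B - {y}) = card B - 1"
    using y assms(2) by (intro card_Diff_singleton) blast
  ultimately show "card (R `` {x}) \<le> card B - 1"
    using card_mono[of "B - {y}" "R `` {x}"] finB by simp
  show "x \<in> A"
    using assms(1) big_subset by blast
next
  fix a assume "a \<in> A" "a \<noteq> x"
  then have "a \<notin> big"
    using assms(1) by blast
  then show "card (R `` {a}) \<le> 2"
    using \<open>a \<in> A\<close> by (simp add: big_def)
qed

text \<open>Freeness of \<open>D_{2,2}\<close> in terms of degrees: if both ends of an edge have
  degree at least 3, each has two further neighbours, and these four are distinct because the two
  pairs lie on different sides.\<close>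

definition no_big_edge :: bool where
  "no_big_edge \<longleftrightarrow> (\<forall>(a, b)\<in>R. card (R `` {a}) \<le> 2 \<or> card (R\<inverse> `` {b}) \<le> 2)"

text \<open>The alternatives are a side without big vertices, a side with exactly one while the
  other side has some, and at least two on each side. The last one keeps the edges between small
  vertices as an extra term, for they are counted from both ends.\<close>

lemma no_big_edge_card_cases:
  assumes free: no_big_edge and n: "card A = n" "card B = n"
  shows "card R \<le> 2 * n \<or> card R \<le> 3 * (n - 1) \<or>
    card R + card (R \<inter> (A - big) \<times> (B - bip.big B (R\<inverse>))) \<le> 4 * n - 8"
proof -
  interpret c: bip B A "R\<inverse>"
    by (rule bip_converse)
  have no: "(a, b) \<notin> R" if "a \<in> big" "b \<in> c.big" for a b
    using that free by (force simp: no_big_edge_def big_def c.big_def)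
  consider "big = {}" | "c.big = {}" | x where "big = {x}" "c.big \<noteq> {}"
    | y where "c.big = {y}" "big \<noteq> {}" | "card big \<ge> 2" "card c.big \<ge> 2"
    using card_ge_2_cases[OF finite_big] card_ge_2_cases[OF c.finite_big] by metis
  then show ?thesis
  proof cases
    case 1
    then show ?thesis using big_emptyD n by simp
  next
    case 2
    then show ?thesis using c.big_emptyD n by simp
  next
    case 3
    then show ?thesis
      using card_le_if_one_big[of x c.big] no c.big_subset n by auto
  next
    case 4
    then show ?thesis
      using c.card_le_if_one_big[of y big] no big_subset n by auto
  next
    case 5
    \<comment> \<open>The edges with a small end in \<open>A\<close> and those with a small end in
      \<open>B\<close>. Together they are all edges, since no edge joins two big vertices.\<close>
    let ?X = "R \<inter> (A - big) \<times> UNIV" and ?Y = "(R\<inverse> \<inter> (B - c.big) \<times> UNIV)\<inverse>"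
    have "card ?X \<le> 2 * card (A - big)"
      by (rule card_Int_Times_le) (auto simp: big_def)
    moreover have "card ?Y \<le> 2 * card (B - c.big)"
      unfolding card_inverse by (rule c.card_Int_Times_le) (auto simp: c.big_def)
    moreover have "card (A - big) = n - card big" "card (B - c.big) = n - card c.big"
      using n big_subset c.big_subset finite_big c.finite_big by (simp_all add: card_Diff_subset)
    moreover have "card big \<le> n" "card c.big \<le> n"
      using n card_mono[OF finA big_subset] card_mono[OF finB c.big_subset] by simp_all
    moreover have "card ?X + card ?Y = card R + card (R \<inter> (A - big) \<times> (B - c.big))"
    proof -
      have "?X \<union> ?Y = R" "?X \<inter> ?Y = R \<inter> (A - big) \<times> (B - c.big)"
        using no RAB by auto
      moreover have "card ?X + card ?Y = card (?X \<union> ?Y) + card (?X \<inter> ?Y)"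
        by (rule card_Un_Int) (auto intro: finite_subset[OF _ finite_R])
      ultimately show ?thesis
        by (simp only:)
    qed
    ultimately have "card R + card (R \<inter> (A - big) \<times> (B - c.big)) \<le> 4 * n - 8"
      using 5 by linarith
    then show ?thesis
      by blast
  qed
qed

text \<open>\<open>2 * n \<le> 3 * (n - 1)\<close> holds from \<open>n = 3\<close> on, and
  \<open>4 * n - 8 \<le> 3 * (n - 1)\<close> up to \<open>n = 5\<close>.\<close>

lemma no_big_edge_card_le:
  assumes no_big_edge "card A = n" "card B = n" "3 \<le> n" "n \<le> 5"
  shows "card R \<le> 3 * (n - 1)"
  using no_big_edge_card_cases[OF assms(1-3)] assms(4-5) by auto

end

lemma (in conn_bip) no_big_edge_conn_card_le:
  assumes free: no_big_edge and n: "card A = n" "card B = n" "n \<ge> 6"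
  shows "card R \<le> 4 * n - 9"
proof -
  interpret c: bip B A "R\<inverse>"
    by (rule bip_converse)
  let ?M = "R \<inter> (A - big) \<times> (B - c.big)"
  consider "big = {}" | "c.big = {}" | "?M = {}" "big \<noteq> {}" "c.big \<noteq> {}" | "?M \<noteq> {}"
    by blast
  then show ?thesis
  proof cases
    case 1
    then show ?thesis using big_emptyD n by simp
  next
    case 2
    then show ?thesis using c.big_emptyD n by simp
  next
    case 3
    have no: "(a, b) \<notin> R" if "a \<in> big" "b \<in> c.big" for a b
      using that free by (force simp: no_big_edge_def big_def c.big_def)
    \<comment> \<open>Big vertices of \<open>A\<close> and small vertices of \<open>B\<close> are
      here adjacent only to each other, so connectedness would leave no big vertex in
      \<open>B\<close>.\<close>
    have "big = A \<and> B - c.big = B"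
      using 3 no RAB big_subset by (intro closed_all) auto
    then show ?thesis
      using 3 c.big_subset by blast
  next
    case 4
    then have "card ?M > 0"
      by (simp add: card_gt_0_iff)
    \<comment> \<open>The doubly counted edge lowers \<open>4 * n - 8\<close> by one, and
      \<open>n \<ge> 6\<close> gives \<open>3 * (n - 1) \<le> 4 * n - 9\<close>.\<close>
    then show ?thesis
      using no_big_edge_card_cases[OF free n(1,2)] n(3) by linarith
  qed
qed

section \<open>Spiders\<close>

text \<open>The centre is \<open>v\<close> and the long leg is \<open>b\<close>, \<open>a\<close>,
  \<open>b'\<close>. Centres in \<open>A\<close> suffice for the bound, since degrees at most 2
  throughout \<open>A\<close> already give at most \<open>2 * n\<close> edges.\<close>

definition spider311_free :: "('a \<times> 'b) set \<Rightarrow> bool" where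
  "spider311_free R \<longleftrightarrow> (\<forall>v b c d a b'. {(v, b), (v, c), (v, d), (a, b), (a, b')} \<subseteq> R \<longrightarrow>
     distinct [b, c, d, b'] \<longrightarrow> a = v)"

text \<open>The centre \<open>v\<close> lies in \<open>A\<close>, the long legs are
  \<open>b\<close>, \<open>a\<close> and \<open>c\<close>, \<open>a'\<close>. Centres in
  \<open>B\<close> are treated through the converse relation.\<close>

definition spider221_free :: "('a \<times> 'b) set \<Rightarrow> bool" where
  "spider221_free R \<longleftrightarrow> (\<forall>v b c d a a'. {(v, b), (v, c), (v, d), (a, b), (a', c)} \<subseteq> R \<longrightarrow>
     distinct [b, c, d] \<longrightarrow> \<not> distinct [v, a, a'])"

lemma spider311_freeD:
  assumes "spider311_free R" "(v, b) \<in> R" "(v, c) \<in> R" "(v, d) \<in> R" "(a, b) \<in> R" "(a, b') \<in> R"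
    "distinct [b, c, d, b']"
  shows "a = v"
  using assms(1)[unfolded spider311_free_def, rule_format, of v b c d a b'] assms(2-) by simp

lemma spider221_freeD:
  assumes "spider221_free R" "(v, b) \<in> R" "(v, c) \<in> R" "(v, d) \<in> R" "(a, b) \<in> R" "(a', c) \<in> R"
    "distinct [b, c, d]"
  shows "\<not> distinct [v, a, a']"
  using assms(1)[unfolded spider221_free_def, rule_format, of v b c d a a'] assms(2-) by simp

context conn_bip
begin

lemma spider311_free_card_le:
  assumes free: "spider311_free R"
    and n: "card A = n" "card B = n" "n \<ge> 4"
  shows "card R \<le> 2 * n"
proof (cases "\<forall>a\<in>A. card (R `` {a}) \<le> 2")
  case True
  then show ?thesis
    using card_R_le_all n by blast
next
  case False
  then obtain v where v: "v \<in> A" "card (R `` {v}) \<ge> 3"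
    by force
  \<comment> \<open>If this fails, \<open>v\<close> has two neighbours \<open>c\<close>,
    \<open>d\<close> other than \<open>b\<close> and \<open>b'\<close>, which complete a spider with
    long leg \<open>b\<close>, \<open>a\<close>, \<open>b'\<close>.\<close>
  have stays: "b' \<in> R `` {v} \<and> card (R `` {v}) = 3"
    if "(v, b) \<in> R" "(a, b) \<in> R" "a \<noteq> v" "(a, b') \<in> R" "b' \<noteq> b" for a b b'
  proof (rule ccontr)
    assume *: "\<not> (b' \<in> R `` {v} \<and> card (R `` {v}) = 3)"
    obtain c where c: "c \<in> R `` {v}" "c \<noteq> b" "c \<noteq> b'"
      using ex_not_in_list[of "[b, b']" "R `` {v}"] v by auto
    have "\<exists>d\<in>R `` {v}. d \<noteq> b \<and> d \<noteq> b' \<and> d \<noteq> c"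
    proof (cases "b' \<in> R `` {v}")
      case True
      then show ?thesis
        using ex_not_in_list[of "[b, b', c]" "R `` {v}"] v * by auto
    next
      case False
      then show ?thesis
        using ex_not_in_list[of "[b, c]" "R `` {v}"] v by auto
    qed
    then show False
      using spider311_freeD[OF free, of v b c _ a b'] that c by auto
  qed
  \<comment> \<open>Now \<open>v\<close> has degree \<open>n \<ge> 4\<close>, which contradicts the
    degree 3 in \<open>stays\<close>. So no other vertex of \<open>A\<close> has a second
    neighbour.\<close>
  have eq: "R\<inverse> `` (R `` {v}) = A \<and> R `` {v} = B"
  proof (rule closed_all)
    show "R `` (R\<inverse> `` (R `` {v})) \<subseteq> R `` {v}"
      using stays by blast
  qed (use RAB v in auto)
  have "card (R `` {a}) \<le> 1" if "a \<in> A" "a \<noteq> v" for a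
  proof -
    have "a \<in> R\<inverse> `` (R `` {v})"
      using eq that by blast
    then obtain b where "(v, b) \<in> R" "(a, b) \<in> R"
      by blast
    then have "R `` {a} \<subseteq> {b}"
      using stays[of b a] that eq n by auto
    then show ?thesis
      by (rule card_le_1_if_subset_singleton)
  qed
  then show ?thesis
    using card_R_le_star v n by fastforce
qed

text \<open>Two non-leaf neighbours of \<open>v\<close> would share a single further neighbour
  \<open>a\<close>. Connectedness leads on beyond \<open>a\<close>, and then \<open>a\<close> is the
  centre of a spider.\<close>

lemma spider221_free_nonleaf_unique:
  assumes free: "spider221_free R"
    and A: "card A \<ge> 3" and v: "card (R `` {v}) \<ge> 3"
    and bc: "b \<in> R `` {v}" "c \<in> R `` {v}" "(a, b) \<in> R" "a \<noteq> v" "(a', c) \<in> R" "a' \<noteq> v"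
  shows "b = c"
proof (rule ccontr)
  assume "b \<noteq> c"
  \<comment> \<open>A third neighbour \<open>z\<close> of \<open>u\<close> is the short leg, so
    distinct \<open>x\<close> and \<open>x'\<close> would complete a spider.\<close>
  have no_matching: "x = x'" if "card (R `` {u}) \<ge> 3" "(u, y) \<in> R" "(u, y') \<in> R" "y \<noteq> y'"
    "(x, y) \<in> R" "x \<noteq> u" "(x', y') \<in> R" "x' \<noteq> u" for u x x' y y'
  proof (rule ccontr)
    assume "x \<noteq> x'"
    have "\<exists>z\<in>R `` {u}. z \<notin> set [y, y']"
      using that by (intro ex_not_in_list) simp
    then obtain z where "(u, z) \<in> R" "z \<noteq> y" "z \<noteq> y'"
      by auto
    then show False
      using spider221_freeD[OF free, of u y y' z x x'] that \<open>x \<noteq> x'\<close> by auto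
  qed
  have "a' = a"
    using no_matching v bc \<open>b \<noteq> c\<close> by blast
  \<comment> \<open>Any \<open>d\<close> differs from \<open>b\<close> or from \<open>c\<close> and
    can be compared with that one.\<close>
  have N: "x = v \<or> x = a" if "(x, d) \<in> R" "(v, d) \<in> R" for x d
    using no_matching[of v d b x a] no_matching[of v d c x a'] v bc \<open>b \<noteq> c\<close> that \<open>a' = a\<close> by blast
  \<comment> \<open>Otherwise \<open>{v, a}\<close> and its neighbours are closed, against
    \<open>card A \<ge> 3\<close>.\<close>
  have "\<exists>w x. (a, w) \<in> R \<and> (v, w) \<notin> R \<and> (x, w) \<in> R \<and> x \<noteq> a \<and> x \<noteq> v"
  proof (rule ccontr)
    assume *: "\<not> ?thesis"
    have "{v, a} = A \<and> R `` {v, a} = B"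
      using RAB bc * N by (intro closed_all) auto
    then show False
      using A by (auto simp: card_insert_if split: if_splits)
  qed
  then obtain w x where w: "(a, w) \<in> R" "(v, w) \<notin> R" "(x, w) \<in> R" "x \<noteq> a" "x \<noteq> v"
    by blast
  \<comment> \<open>The vertex \<open>a\<close> has degree at least 3, and its neighbours
    \<open>b\<close> and \<open>w\<close> lead on to the distinct vertices \<open>v\<close> and
    \<open>x\<close>.\<close>
  have "card {b, c, w} \<le> card (R `` {a})"
    using w bc \<open>a' = a\<close> by (intro card_mono) auto
  moreover have "card {b, c, w} = 3"
    using w bc \<open>b \<noteq> c\<close> by (auto simp: card_insert_if)
  ultimately show False
    using no_matching[of a b w v x] w bc by auto
qed

text \<open>Discharging: degrees above 2 in \<open>A\<close> are paid for by leaves in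
  \<open>B\<close>, each of which pays only once. The two leaf counts stand on opposite sides so
  that they cancel against the inequality for the converse.\<close>

lemma spider221_free_sum_le:
  assumes free: "spider221_free R"
    and A: "card A \<ge> 3"
  shows "card R + card {a \<in> A. card (R `` {a}) = 1} \<le> 2 * card A + card {b \<in> B. card (R\<inverse> `` {b}) = 1}"
proof -
  let ?L = "{b \<in> B. card (R\<inverse> `` {b}) = 1}"
  \<comment> \<open>A vertex of degree 1 has one unit to spare, which accounts for the leaves of
    \<open>A\<close>. From degree 3 on, all neighbours but at most one are leaves.\<close>
  have deg: "card (R `` {a}) + (if card (R `` {a}) = 1 then 1 else 0) \<le> 2 + card (R `` {a} \<inter> ?L)" for a
  proof (cases "card (R `` {a}) \<ge> 3")
    case True
    have "\<forall>b\<in>R `` {a} - ?L. \<forall>c\<in>R `` {a} - ?L. b = c"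
    proof (intro ballI)
      have other: "\<exists>x. (x, b) \<in> R \<and> x \<noteq> a" if "b \<in> R `` {a} - ?L" for b
      proof (rule ccontr)
        assume "\<not> ?thesis"
        then have "R\<inverse> `` {b} = {a}"
          using that by blast
        moreover have "b \<in> B"
          using that RAB by blast
        ultimately show False
          using that by simp
      qed
      fix b c assume bc: "b \<in> R `` {a} - ?L" "c \<in> R `` {a} - ?L"
      obtain x y where "(x, b) \<in> R" "x \<noteq> a" "(y, c) \<in> R" "y \<noteq> a"
        using other[OF bc(1)] other[OF bc(2)] by blast
      then show "b = c"
        using bc by (intro spider221_free_nonleaf_unique[OF free A True, of b c x y]) simp_all
    qed
    then have "card (R `` {a} - ?L) \<le> Suc 0"
      using card_le_Suc0_iff_eq[OF finite_Diff[OF finite_Image]] by blast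
    moreover have "card (R `` {a}) = card (R `` {a} \<inter> ?L) + card (R `` {a} - ?L)"
      by (rule card_Int_Diff[OF finite_Image])
    moreover have "card (R `` {a}) \<noteq> 1"
      using True by linarith
    ultimately show ?thesis
      unfolding if_not_P[OF \<open>card (R `` {a}) \<noteq> 1\<close>] by linarith
  next
    case False
    moreover have "m + (if m = 1 then 1 else 0) \<le> 2 + k" if "\<not> 3 \<le> m" for m k :: nat
      using that by simp
    ultimately show ?thesis
      by blast
  qed
  have "card R + card {a \<in> A. card (R `` {a}) = 1} =
      (\<Sum>a\<in>A. card (R `` {a}) + (if card (R `` {a}) = 1 then 1 else 0))"
    using finA by (simp add: card_R sum.distrib sum.If_cases Int_def)
  also have "\<dots> \<le> (\<Sum>a\<in>A. 2 + card (R `` {a} \<inter> ?L))"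
    by (intro sum_mono deg)
  also have "\<dots> = 2 * card A + card (Sigma A (\<lambda>a. R `` {a} \<inter> ?L))"
    using finA by (subst sum.distrib) simp
  \<comment> \<open>Seen from \<open>B\<close>, these pairs are the edges at leaves, one for each
    leaf.\<close>
  also have "Sigma A (\<lambda>a. R `` {a} \<inter> ?L) = (R\<inverse> \<inter> ?L \<times> UNIV)\<inverse>"
    using RAB by auto
  also have "card \<dots> \<le> 1 * card ?L"
    unfolding card_inverse by (rule bip.card_Int_Times_le[OF bip_converse]) auto
  finally show ?thesis
    by simp
qed

end

section \<open>From graphs to relations\<close>

definition bip_graph :: "'a set \<Rightarrow> 'a set \<Rightarrow> ('a \<times> 'a) set \<Rightarrow> 'a graph" where
  "bip_graph A B R = (A \<union> B, (\<lambda>(a, b). {a, b}) ` R)"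

lemma verts_bip_graph [simp]: "verts (bip_graph A B R) = A \<union> B"
  by (simp add: bip_graph_def)

lemma edge_bip_graph_iff [simp]:
  "{x, y} \<in> edges (bip_graph A B R) \<longleftrightarrow> (x, y) \<in> R \<or> (y, x) \<in> R"
  by (force simp: bip_graph_def doubleton_eq_iff)

locale disj_bip = bip A B R for A B :: "'a set" and R +
  assumes disj: "A \<inter> B = {}"
begin

lemma mem_partsD: "(x, y) \<in> R \<Longrightarrow> x \<in> A \<and> y \<in> B \<and> x \<notin> B \<and> y \<notin> A"
  using RAB disj by blast

lemma card_edges_bip_graph: "card (edges (bip_graph A B R)) = card R"
proof -
  have "(y, x) \<notin> R" if "(x, y) \<in> R" for x y
    using mem_partsD[OF that] mem_partsD[of y x] by blast
  then have "inj_on (\<lambda>(a, b). {a, b}) R"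
    by (auto simp: inj_on_def doubleton_eq_iff)
  then show ?thesis
    by (simp add: bip_graph_def card_image)
qed

lemma balanced_bip_graph:
  assumes "card A = n" "card B = n"
  shows "balanced_bipartite n (bip_graph A B R)"
proof -
  have "bipartition (bip_graph A B R) A B"
    using RAB disj by (auto simp: bipartition_def bip_graph_def)
  moreover have "card {a, b} = 2" if "(a, b) \<in> R" for a b
    using mem_partsD[OF that] by (auto simp: card_insert_if)
  then have "simple_graph (bip_graph A B R)"
    using RAB finA finB by (auto simp: simple_graph_def bip_graph_def)
  ultimately show ?thesis
    using assms finA finB unfolding balanced_bipartite_def by blast
qed

text \<open>A walk that starts in a closed set never leaves it.\<close>

lemma conn_bip_if_connected_graph:
  assumes "connected_graph (bip_graph A B R)"
  shows "conn_bip A B R"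
proof
  fix S T assume ST: "S \<subseteq> A" "T \<subseteq> B" "R `` S \<subseteq> T" "R\<inverse> `` T \<subseteq> S" "S \<noteq> {} \<or> T \<noteq> {}"
  obtain r where r: "r \<in> S \<union> T"
    using ST(5) by blast
  have "v \<in> S \<union> T" if "(r, v) \<in> (adj_rel (bip_graph A B R))\<^sup>*" for v
    using that
  proof induction
    case (step x y)
    then have "(x, y) \<in> R \<or> (y, x) \<in> R"
      by (simp add: adj_rel_def)
    then show ?case
      using step.IH ST(1-4) RAB disj by blast
  qed (rule r)
  then have "A \<union> B \<subseteq> S \<union> T"
    using assms r ST(1,2) unfolding connected_graph_def verts_bip_graph by blast
  then show "S = A \<and> T = B"
    using ST(1,2) disj by blast
qed

end

lemma balanced_bipartiteE:
  assumes "balanced_bipartite n G"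
  obtains A B R where "disj_bip A B R" "card A = n" "card B = n" "G = bip_graph A B R"
proof -
  obtain A B where AB: "bipartition G A B" "finite A" "card A = n" "finite B" "card B = n"
    using assms unfolding balanced_bipartite_def by blast
  define R where "R = {(a, b). a \<in> A \<and> b \<in> B \<and> {a, b} \<in> edges G}"
  have "disj_bip A B R"
    using AB by unfold_locales (auto simp: R_def bipartition_def)
  moreover have "edges G = edges (bip_graph A B R)"
    using AB(1) by (force simp: R_def bipartition_def bip_graph_def image_iff)
  then have "G = bip_graph A B R"
    using AB(1) by (simp add: bipartition_def prod_eq_iff)
  ultimately show thesis
    using that AB by blast
qed

lemma ex_b_eqI:
  fixes A B :: "nat set"
  assumes upper: "\<And>(A :: nat set) B R. disj_bip A B R \<Longrightarrow> card A = n \<Longrightarrow> card B = n \<Longrightarrow>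
      graph_free F (bip_graph A B R) \<Longrightarrow> card R \<le> m"
    and "disj_bip A B R" "card A = n" "card B = n" "graph_free F (bip_graph A B R)" "card R = m"
  shows "ex_b n F = m"
  unfolding ex_b_def
proof (rule Max_eqI[OF finite_ex_b_set])
  fix k assume "k \<in> {card (edges G) | G :: nat graph. balanced_bipartite n G \<and> graph_free F G}"
  then obtain G :: "nat graph" where "k = card (edges G)" "balanced_bipartite n G" "graph_free F G"
    by blast
  then show "k \<le> m"
    using upper by (metis balanced_bipartiteE disj_bip.card_edges_bip_graph)
next
  show "m \<in> {card (edges G) | G :: nat graph. balanced_bipartite n G \<and> graph_free F G}"
    unfolding mem_Collect_eq using assms(2-)
    by (metis disj_bip.card_edges_bip_graph disj_bip.balanced_bip_graph)
qed

lemma ex_bc_eqI: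
  fixes A B :: "nat set"
  assumes upper: "\<And>(A :: nat set) B R. disj_bip A B R \<Longrightarrow> conn_bip A B R \<Longrightarrow> card A = n \<Longrightarrow>
      card B = n \<Longrightarrow> graph_free F (bip_graph A B R) \<Longrightarrow> card R \<le> m"
    and "disj_bip A B R" "card A = n" "card B = n" "connected_graph (bip_graph A B R)"
      "graph_free F (bip_graph A B R)" "card R = m"
  shows "ex_bc n F = m"
  unfolding ex_bc_def
proof (rule Max_eqI[OF finite_ex_bc_set])
  fix k assume "k \<in> {card (edges G) | G :: nat graph.
    balanced_bipartite n G \<and> connected_graph G \<and> graph_free F G}"
  then obtain G :: "nat graph" where "k = card (edges G)" "balanced_bipartite n G"
    "connected_graph G" "graph_free F G"
    by blast
  then show "k \<le> m"
    using upper
    by (metis balanced_bipartiteE disj_bip.card_edges_bip_graph disj_bip.conn_bip_if_connected_graph)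
next
  show "m \<in> {card (edges G) | G :: nat graph.
    balanced_bipartite n G \<and> connected_graph G \<and> graph_free F G}"
    unfolding mem_Collect_eq using assms(2-)
    by (metis disj_bip.card_edges_bip_graph disj_bip.balanced_bip_graph)
qed

text \<open>The copy of \<open>F\<close> is its image under \<open>f\<close>. Injectivity keeps the
  edges two-element, so the image is simple, as \<open>subgraph\<close> demands.\<close>

lemma graph_free_iff:
  assumes "simple_graph F"
  shows "graph_free F G \<longleftrightarrow>
    \<not> (\<exists>f. inj_on f (verts F) \<and> f ` verts F \<subseteq> verts G \<and> (\<forall>e\<in>edges F. f ` e \<in> edges G))"
proof -
  have "(\<exists>H. subgraph H G \<and> graph_iso F H) \<longleftrightarrow>
    (\<exists>f. inj_on f (verts F) \<and> f ` verts F \<subseteq> verts G \<and> (\<forall>e\<in>edges F. f ` e \<in> edges G))"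
    (is "?L \<longleftrightarrow> ?R")
  proof
    assume ?L
    then obtain H f where H: "verts H \<subseteq> verts G" "edges H \<subseteq> edges G"
      and f: "bij_betw f (verts F) (verts H)" "edges H = (\<lambda>e. f ` e) ` edges F"
      unfolding subgraph_def graph_iso_def by (elim exE conjE) (rule that)
    have "f ` e \<in> edges G" if "e \<in> edges F" for e
      using that f(2) H(2) by (simp add: image_subset_iff)
    then show ?R
      using H(1) f(1) by (intro exI[of _ f]) (simp add: bij_betw_def)
  next
    assume ?R
    then obtain f where f: "inj_on f (verts F)" "f ` verts F \<subseteq> verts G" "\<forall>e\<in>edges F. f ` e \<in> edges G"
      by blast
    let ?H = "(f ` verts F, (\<lambda>e. f ` e) ` edges F)"
    have "card (f ` e) = 2" if "e \<in> edges F" for e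
      using that assms card_image[of f e] inj_on_subset[OF f(1)] by (simp add: simple_graph_def)
    then have "simple_graph ?H"
      using assms unfolding simple_graph_def by auto
    then have "subgraph ?H G"
      using f unfolding subgraph_def by auto
    moreover have "graph_iso F ?H"
      using f(1) unfolding graph_iso_def bij_betw_def by auto
    ultimately show ?L
      by blast
  qed
  then show ?thesis
    unfolding graph_free_def by blast
qed

section \<open>The forbidden graphs\<close>

lemma simple_path_graph: "simple_graph (path_graph k)"
  by (auto simp: simple_graph_def path_graph_def)

text \<open>The shorter path is an initial segment of the longer one. This carries the upper bound
  from \<open>P_6\<close> to \<open>P_5\<close> and the freeness of the example from
  \<open>P_5\<close> to \<open>P_6\<close>.\<close>

lemma path_graph_free_mono:
  assumes "graph_free (path_graph k) G" "k \<le> l"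
  shows "graph_free (path_graph l) G"
proof -
  have "verts (path_graph k) \<subseteq> verts (path_graph l)" "edges (path_graph k) \<subseteq> edges (path_graph l)"
    using assms(2) by (auto simp: path_graph_def)
  then show ?thesis
    using assms(1) unfolding graph_free_iff[OF simple_path_graph]
    by (meson image_mono inj_on_subset subset_iff subset_trans)
qed

lemma (in disj_bip) path_graph6_free_imp:
  assumes "graph_free (path_graph 6) (bip_graph A B R)"
  shows "\<not> has_path6 R"
proof
  assume "has_path6 R"
  then obtain a1 a2 a3 b1 b2 b3 where
    *: "distinct [a1, a2, a3]" "distinct [b1, b2, b3]"
      "{(a1, b1), (a2, b1), (a2, b2), (a3, b2), (a3, b3)} \<subseteq> R"
    unfolding has_path6_def by (elim exE conjE) (rule that)
  let ?xs = "[a1, b1, a2, b2, a3, b3]"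
  have in_parts: "{a1, a2, a3} \<subseteq> A" "{b1, b2, b3} \<subseteq> B"
    using *(3) RAB by auto
  then have "distinct ?xs"
    using *(1,2) disj by auto
  then have "inj_on (nth ?xs) {..<6}"
    by (rule inj_on_nth) simp
  moreover have "nth ?xs ` {..<6} \<subseteq> set ?xs"
    by (intro image_subsetI nth_mem) simp
  moreover have "{?xs ! i, ?xs ! Suc i} \<in> edges (bip_graph A B R)" if "Suc i < 6" for i
  proof -
    have "i = 0 \<or> i = 1 \<or> i = 2 \<or> i = 3 \<or> i = 4"
      using that by linarith
    then show ?thesis
      using *(3) by (elim disjE) simp_all
  qed
  then have "\<forall>e\<in>edges (path_graph 6). nth ?xs ` e \<in> edges (bip_graph A B R)"
    unfolding path_graph_def snd_conv by (intro ballI) (elim CollectE exE conjE, simp only: image_insert image_empty)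
  moreover have "set ?xs \<subseteq> A \<union> B" "verts (path_graph 6) = {..<6}"
    using in_parts by (auto simp: path_graph_def)
  ultimately show False
    using assms unfolding graph_free_iff[OF simple_path_graph] verts_bip_graph by (metis subset_trans)
qed

section \<open>Double stars and degrees\<close>

lemma simple_double_star: "simple_graph (double_star a b)"
  by (auto simp: simple_graph_def double_star_def)

lemma verts_double_star22:
  "verts (double_star 2 2) = {CentreU, CentreV, LeafU 0, LeafU 1, LeafV 0, LeafV 1}"
  by (auto simp: double_star_def less_2_cases_iff)

lemma edges_double_star22:
  "edges (double_star 2 2) = {{CentreU, CentreV}, {CentreU, LeafU 0}, {CentreU, LeafU 1},
     {CentreV, LeafV 0}, {CentreV, LeafV 1}}"
  by (auto simp: double_star_def less_2_cases_iff)

lemma card_ge_3_obtain: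
  assumes "card X \<ge> 3"
  obtains x y where "x \<in> X" "y \<in> X" "x \<noteq> y" "x \<noteq> z" "y \<noteq> z"
proof -
  obtain x where "x \<in> X" "x \<noteq> z"
    using ex_not_in_list[of "[z]" X] assms by auto
  moreover obtain y where "y \<in> X" "y \<noteq> z" "y \<noteq> x"
    using ex_not_in_list[of "[z, x]" X] assms by auto
  ultimately show thesis
    using that by metis
qed

lemma three_subset_card_ge:
  assumes "{x, y, z} \<subseteq> X" "finite X" "distinct [x, y, z]"
  shows "3 \<le> card X"
  using card_mono[OF assms(2,1)] assms(3) by simp

lemma (in disj_bip) double_star_free_iff:
  "graph_free (double_star 2 2) (bip_graph A B R) \<longleftrightarrow> no_big_edge"
proof
  assume free: "graph_free (double_star 2 2) (bip_graph A B R)"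
  show no_big_edge
  proof (rule ccontr)
    assume "\<not> no_big_edge"
    then obtain u v where uv: "(u, v) \<in> R" "3 \<le> card (R `` {u})" "3 \<le> card (R\<inverse> `` {v})"
      unfolding no_big_edge_def by fastforce
    obtain x y where xy: "x \<in> R `` {u}" "y \<in> R `` {u}" "x \<noteq> y" "x \<noteq> v" "y \<noteq> v"
      using card_ge_3_obtain[OF uv(2)] .
    obtain z w where zw: "z \<in> R\<inverse> `` {v}" "w \<in> R\<inverse> `` {v}" "z \<noteq> w" "z \<noteq> u" "w \<noteq> u"
      using card_ge_3_obtain[OF uv(3)] .
    define f where "f t = (case t of CentreU \<Rightarrow> u | CentreV \<Rightarrow> v
      | LeafU i \<Rightarrow> if i = 0 then x else y | LeafV i \<Rightarrow> if i = 0 then z else w)" for t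
    have in_parts: "{u, z, w} \<subseteq> A" "{v, x, y} \<subseteq> B"
      using uv xy zw RAB by auto
    have "distinct [u, z, w, v, x, y]"
      using xy zw in_parts disj by auto
    then have "inj_on f (verts (double_star 2 2))"
      unfolding verts_double_star22 f_def by auto
    moreover have "f ` verts (double_star 2 2) \<subseteq> verts (bip_graph A B R)"
      unfolding verts_double_star22 f_def using in_parts by simp
    moreover have "\<forall>e\<in>edges (double_star 2 2). f ` e \<in> edges (bip_graph A B R)"
      unfolding edges_double_star22 f_def using uv xy zw by simp
    ultimately show False
      using free unfolding graph_free_iff[OF simple_double_star] by blast
  qed
next
  assume nb: no_big_edge
  show "graph_free (double_star 2 2) (bip_graph A B R)"
    unfolding graph_free_iff[OF simple_double_star]
  proof
    assume "\<exists>f. inj_on f (verts (double_star 2 2)) \<and>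
      f ` verts (double_star 2 2) \<subseteq> verts (bip_graph A B R) \<and>
      (\<forall>e\<in>edges (double_star 2 2). f ` e \<in> edges (bip_graph A B R))"
    then obtain f where f: "inj_on f (verts (double_star 2 2))"
      and e: "\<And>e. e \<in> edges (double_star 2 2) \<Longrightarrow> f ` e \<in> edges (bip_graph A B R)"
      by blast
    have d: "distinct [f CentreV, f (LeafU 0), f (LeafU 1)]" "distinct [f CentreU, f (LeafV 0), f (LeafV 1)]"
      using f unfolding verts_double_star22 by (simp_all add: inj_on_eq_iff[OF f[unfolded verts_double_star22]])
    have eUV: "{f CentreU, f CentreV} \<in> edges (bip_graph A B R)"
      using e[of "{CentreU, CentreV}"] by (simp add: edges_double_star22)
    have eU: "{f CentreU, f (LeafU i)} \<in> edges (bip_graph A B R)" if "i < 2" for i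
      using e[of "{CentreU, LeafU i}"] that by (auto simp: edges_double_star22 less_2_cases_iff)
    have eV: "{f CentreV, f (LeafV i)} \<in> edges (bip_graph A B R)" if "i < 2" for i
      using e[of "{CentreV, LeafV i}"] that by (auto simp: edges_double_star22 less_2_cases_iff)
    \<comment> \<open>Once the central edge points from \<open>a\<close> to \<open>b\<close>, the
      sides determine the direction of the leaf edges.\<close>
    have orient: "(a, x) \<in> R" "(y, b) \<in> R"
      if "(a, b) \<in> R" "{a, x} \<in> edges (bip_graph A B R)" "{b, y} \<in> edges (bip_graph A B R)" for a b x y
      using that RAB disj by auto
    \<comment> \<open>Stated for arbitrary ends and leaves so that it covers both orientations of
      the central edge.\<close>
    have no_double: False if ab: "(a, b) \<in> R"
      and x: "\<And>i. i < 2 \<Longrightarrow> {a, x i} \<in> edges (bip_graph A B R)" "distinct [b, x 0, x (1 :: nat)]"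
      and y: "\<And>i. i < 2 \<Longrightarrow> {b, y i} \<in> edges (bip_graph A B R)" "distinct [a, y 0, y (1 :: nat)]"
    for a b x y
    proof -
      have "(a, x i) \<in> R" "(y i, b) \<in> R" if "i < 2" for i
        using orient[OF ab x(1)[OF that] y(1)[OF that]] .
      then have "{b, x 0, x 1} \<subseteq> R `` {a}" "{a, y 0, y 1} \<subseteq> R\<inverse> `` {b}"
        using ab by auto
      then have "3 \<le> card (R `` {a})" "3 \<le> card (R\<inverse> `` {b})"
        using three_subset_card_ge x(2) y(2) finite_Image bip.finite_Image[OF bip_converse] by metis+
      then show False
        using nb ab unfolding no_big_edge_def by fastforce
    qed
    show False
      using eUV no_double[of "f CentreU" "f CentreV" "\<lambda>i. f (LeafU i)" "\<lambda>i. f (LeafV i)"]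
        no_double[of "f CentreV" "f CentreU" "\<lambda>i. f (LeafV i)" "\<lambda>i. f (LeafU i)"] eU eV d by auto
  qed
qed

section \<open>Spiders\<close>

lemma simple_spider: "simple_graph (spider as)"
proof -
  have "{spider_vertex i d |i d. i < length as \<and> d \<le> as ! i} =
      (\<Union>i\<in>{..<length as}. spider_vertex i ` {..as ! i})"
    by auto
  then have "finite (verts (spider as))"
    by (simp add: spider_def)
  moreover have "card {spider_vertex i d, spider_vertex i (Suc d)} = 2" for i d
    by (simp add: spider_vertex_def)
  ultimately show ?thesis
    unfolding simple_graph_def spider_def using less_imp_le Suc_leI by fastforce
qed

lemma (in disj_bip) spider_free_if_degree_le_2:
  assumes "\<And>a. card (R `` {a}) \<le> 2" "\<And>b. card (R\<inverse> `` {b}) \<le> 2"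
    and as: "length as = 3" "\<And>i. i < 3 \<Longrightarrow> as ! i > 0"
  shows "graph_free (spider as) (bip_graph A B R)"
  unfolding graph_free_iff[OF simple_spider]
proof
  assume "\<exists>f. inj_on f (verts (spider as)) \<and> f ` verts (spider as) \<subseteq> verts (bip_graph A B R) \<and>
      (\<forall>e\<in>edges (spider as). f ` e \<in> edges (bip_graph A B R))"
  then obtain f where f: "inj_on f (verts (spider as))"
    and e: "\<And>e. e \<in> edges (spider as) \<Longrightarrow> f ` e \<in> edges (bip_graph A B R)"
    by blast
  define x where "x i = f (Some (i, 1))" for i
  have V: "Some (i, 1) \<in> verts (spider as)" if "i < 3" for i
    using that as(1) as(2)[of i] unfolding spider_def by (force simp: spider_vertex_def)
  have E: "{None, Some (i, 1)} \<in> edges (spider as)" if "i < 3" for i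
    using that as unfolding spider_def snd_conv mem_Collect_eq
    by (intro exI[of _ i] exI[of _ 0]) (simp add: spider_vertex_def)
  have adj: "(f None, x i) \<in> R \<or> (x i, f None) \<in> R" if "i < 3" for i
    using e[OF E[OF that]] by (simp add: x_def)
  have dist: "distinct [x 0, x 1, x 2]"
    using inj_onD[OF f _ V V] unfolding x_def by fastforce
  \<comment> \<open>All neighbours of the image of the centre lie on the opposite side, so the three
    edges are oriented alike.\<close>
  have "{x 0, x 1, x 2} \<subseteq> R `` {f None} \<or> {x 0, x 1, x 2} \<subseteq> R\<inverse> `` {f None}"
    using adj[of 0] adj[of 1] adj[of 2] RAB disj by auto
  then have "3 \<le> card (R `` {f None}) \<or> 3 \<le> card (R\<inverse> `` {f None})"
    using three_subset_card_ge dist finite_Image bip.finite_Image[OF bip_converse] by metis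
  then show False
    using assms(1,2)[of "f None"] by linarith
qed

lemma (in disj_bip) spider311_free_imp:
  assumes free: "graph_free (spider [3, 1, 1]) (bip_graph A B R)"
  shows "spider311_free R"
  unfolding spider311_free_def
proof (intro allI impI, rule ccontr)
  fix v b c d a b'
  assume *: "{(v, b), (v, c), (v, d), (a, b), (a, b')} \<subseteq> R" "distinct [b, c, d, b']" "a \<noteq> v"
  \<comment> \<open>Row \<open>i\<close> of the table is leg \<open>i\<close>, read outwards from
    the centre. The distance \<open>k\<close> starts at 1, hence the index
    \<open>k - 1\<close>.\<close>
  define f where "f t = (case t of None \<Rightarrow> v | Some (i, k) \<Rightarrow> [[b, a, b'], [c], [d]] ! i ! (k - 1))"
    for t :: "(nat \<times> nat) option"
  have V: "verts (spider [3, 1, 1]) \<subseteq> {None, Some (0, 1), Some (0, 2), Some (0, 3), Some (1, 1), Some (2, 1)}" (is "_ \<subseteq> ?V")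
  proof
    fix x assume "x \<in> verts (spider [3, 1, 1])"
    then obtain i d where x: "x = spider_vertex i d" and "i < 3" "d \<le> [3, 1, 1] ! i"
      by (auto simp: spider_def)
    then have "i = 0 \<and> (d = 0 \<or> d = 1 \<or> d = 2 \<or> d = 3) \<or> i = 1 \<and> (d = 0 \<or> d = 1) \<or> i = 2 \<and> (d = 0 \<or> d = 1)"
      by (cases "i = 0"; cases "i = 1"; cases "i = 2") (simp_all, presburger+)
    then show "x \<in> ?V"
      by (elim disjE conjE) (simp_all add: x spider_vertex_def)
  qed
  have E: "edges (spider [3, 1, 1]) \<subseteq> {{None, Some (0, 1)}, {Some (0, 1), Some (0, 2)},
      {Some (0, 2), Some (0, 3)}, {None, Some (1, 1)}, {None, Some (2, 1)}}" (is "_ \<subseteq> ?E")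
  proof
    fix e assume "e \<in> edges (spider [3, 1, 1])"
    then obtain i d where e: "e = {spider_vertex i d, spider_vertex i (Suc d)}" and "i < 3" "d < [3, 1, 1] ! i"
      by (auto simp: spider_def)
    then have "i = 0 \<and> (d = 0 \<or> d = 1 \<or> d = 2) \<or> i = 1 \<and> d = 0 \<or> i = 2 \<and> d = 0"
      by (cases "i = 0"; cases "i = 1"; cases "i = 2") (simp_all, presburger+)
    then show "e \<in> ?E"
      by (elim disjE conjE) (simp_all add: e spider_vertex_def numeral_eq_Suc)
  qed
  have in_parts: "{v, a} \<subseteq> A" "{b, c, d, b'} \<subseteq> B"
    using * RAB by auto
  then have "distinct [v, a, b, c, d, b']"
    using * disj by auto
  then have "inj_on f {None, Some (0, 1), Some (0, 2), Some (0, 3), Some (1, 1), Some (2, 1)}"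
    by (auto simp: f_def inj_on_def)
  then have "inj_on f (verts (spider [3, 1, 1]))"
    using V by (rule inj_on_subset)
  moreover have "f ` {None, Some (0, 1), Some (0, 2), Some (0, 3), Some (1, 1), Some (2, 1)} \<subseteq> A \<union> B"
    using in_parts by (simp add: f_def)
  then have "f ` verts (spider [3, 1, 1]) \<subseteq> verts (bip_graph A B R)"
    using image_mono[OF V, of f] unfolding verts_bip_graph by (rule subset_trans[rotated])
  moreover have "\<forall>e\<in>{{None, Some (0, 1)}, {Some (0, 1), Some (0, 2)},
      {Some (0, 2), Some (0, 3)}, {None, Some (1, 1)}, {None, Some (2, 1)}}. f ` e \<in> edges (bip_graph A B R)"
    using * by (simp add: f_def)
  then have "\<forall>e\<in>edges (spider [3, 1, 1]). f ` e \<in> edges (bip_graph A B R)"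
    using subsetD[OF E] by (intro ballI) (erule bspec)
  ultimately show False
    using free unfolding graph_free_iff[OF simple_spider] by blast
qed

lemma (in disj_bip) spider221_free_imp:
  assumes free: "graph_free (spider [2, 2, 1]) (bip_graph A B R)"
  shows "spider221_free R"
  unfolding spider221_free_def
proof (intro allI impI notI)
  fix v b c d a a'
  assume *: "{(v, b), (v, c), (v, d), (a, b), (a', c)} \<subseteq> R" "distinct [b, c, d]" "distinct [v, a, a']"
  \<comment> \<open>Again the rows are the legs, read outwards from \<open>v\<close>.\<close>
  define f where "f t = (case t of None \<Rightarrow> v | Some (i, k) \<Rightarrow> [[b, a], [c, a'], [d]] ! i ! (k - 1))"
    for t :: "(nat \<times> nat) option"
  have V: "verts (spider [2, 2, 1]) \<subseteq> {None, Some (0, 1), Some (0, 2), Some (1, 1), Some (1, 2), Some (2, 1)}" (is "_ \<subseteq> ?V")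
  proof
    fix x assume "x \<in> verts (spider [2, 2, 1])"
    then obtain i d where x: "x = spider_vertex i d" and "i < 3" "d \<le> [2, 2, 1] ! i"
      by (auto simp: spider_def)
    then have "i = 0 \<and> (d = 0 \<or> d = 1 \<or> d = 2) \<or> i = 1 \<and> (d = 0 \<or> d = 1 \<or> d = 2) \<or> i = 2 \<and> (d = 0 \<or> d = 1)"
      by (cases "i = 0"; cases "i = 1"; cases "i = 2") (simp_all, presburger+)
    then show "x \<in> ?V"
      by (elim disjE conjE) (simp_all add: x spider_vertex_def)
  qed
  have E: "edges (spider [2, 2, 1]) \<subseteq> {{None, Some (0, 1)}, {Some (0, 1), Some (0, 2)},
      {None, Some (1, 1)}, {Some (1, 1), Some (1, 2)}, {None, Some (2, 1)}}" (is "_ \<subseteq> ?E")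
  proof
    fix e assume "e \<in> edges (spider [2, 2, 1])"
    then obtain i d where e: "e = {spider_vertex i d, spider_vertex i (Suc d)}" and "i < 3" "d < [2, 2, 1] ! i"
      by (auto simp: spider_def)
    then have "i = 0 \<and> (d = 0 \<or> d = 1) \<or> i = 1 \<and> (d = 0 \<or> d = 1) \<or> i = 2 \<and> d = 0"
      by (cases "i = 0"; cases "i = 1"; cases "i = 2") (simp_all, presburger+)
    then show "e \<in> ?E"
      by (elim disjE conjE) (simp_all add: e spider_vertex_def numeral_eq_Suc)
  qed
  have in_parts: "{v, a, a'} \<subseteq> A" "{b, c, d} \<subseteq> B"
    using * RAB by auto
  then have "distinct [v, a, a', b, c, d]"
    using * disj by auto
  then have "inj_on f {None, Some (0, 1), Some (0, 2), Some (1, 1), Some (1, 2), Some (2, 1)}"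
    by (auto simp: f_def inj_on_def)
  then have "inj_on f (verts (spider [2, 2, 1]))"
    using V by (rule inj_on_subset)
  moreover have "f ` {None, Some (0, 1), Some (0, 2), Some (1, 1), Some (1, 2), Some (2, 1)} \<subseteq> A \<union> B"
    using in_parts by (simp add: f_def)
  then have "f ` verts (spider [2, 2, 1]) \<subseteq> verts (bip_graph A B R)"
    using image_mono[OF V, of f] unfolding verts_bip_graph by (rule subset_trans[rotated])
  moreover have "\<forall>e\<in>{{None, Some (0, 1)}, {Some (0, 1), Some (0, 2)},
      {None, Some (1, 1)}, {Some (1, 1), Some (1, 2)}, {None, Some (2, 1)}}. f ` e \<in> edges (bip_graph A B R)"
    using * by (simp add: f_def)
  then have "\<forall>e\<in>edges (spider [2, 2, 1]). f ` e \<in> edges (bip_graph A B R)"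
    using subsetD[OF E] by (intro ballI) (erule bspec)
  ultimately show False
    using free unfolding graph_free_iff[OF simple_spider] by blast
qed

section \<open>Extremal examples\<close>

lemma card_doubleton_le: "X \<subseteq> {x, y} \<Longrightarrow> card X \<le> 2"
  using card_mono[of "{x, y}" X] by (simp add: card_insert_if split: if_splits)

section \<open>Graphs given by the neighbourhoods of the vertices below \<open>n\<close>\<close>

abbreviation upper_part :: "nat \<Rightarrow> nat set" where
  "upper_part n \<equiv> {n..<2 * n}"

lemma disj_bip_Sigma:
  assumes "\<And>a. a < n \<Longrightarrow> N a \<subseteq> upper_part n"
  shows "disj_bip {..<n} (upper_part n) (Sigma {..<n} N)"
  using assms by unfold_locales auto

abbreviation Sigma_graph :: "nat \<Rightarrow> (nat \<Rightarrow> nat set) \<Rightarrow> nat graph" where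
  "Sigma_graph n N \<equiv> bip_graph {..<n} (upper_part n) (Sigma {..<n} N)"

abbreviation reach :: "nat \<Rightarrow> (nat \<Rightarrow> nat set) \<Rightarrow> nat set" where
  "reach n N \<equiv> {v. (0, v) \<in> (adj_rel (Sigma_graph n N))\<^sup>*}"

lemma zero_reach: "0 \<in> reach n N"
  by simp

lemma reach_up: "a \<in> reach n N \<Longrightarrow> a < n \<Longrightarrow> b \<in> N a \<Longrightarrow> b \<in> reach n N"
  by (auto simp: adj_rel_def elim!: rtrancl_into_rtrancl)

lemma reach_down: "b \<in> reach n N \<Longrightarrow> a < n \<Longrightarrow> b \<in> N a \<Longrightarrow> a \<in> reach n N"
  by (auto simp: adj_rel_def elim!: rtrancl_into_rtrancl)

text \<open>Adjacency is symmetric, so any two vertices are joined by a walk through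
  \<open>0\<close>.\<close>

lemma connected_Sigma_graphI:
  assumes "n > 0" "\<And>a. a < n \<Longrightarrow> a \<in> reach n N"
    "\<And>b. n \<le> b \<Longrightarrow> b < 2 * n \<Longrightarrow> b \<in> reach n N"
  shows "connected_graph (Sigma_graph n N)"
proof -
  let ?E = "adj_rel (Sigma_graph n N)"
  have all: "(0, v) \<in> ?E\<^sup>*" if "v \<in> {..<n} \<union> upper_part n" for v
    using that assms(2,3)[of v] by auto
  have "sym ?E"
    by (auto simp: sym_def adj_rel_def)
  then have "(u, v) \<in> ?E\<^sup>*" if "u \<in> {..<n} \<union> upper_part n" "v \<in> {..<n} \<union> upper_part n" for u v
    using all[OF that(1)] all[OF that(2)] by (meson rtrancl_trans symD sym_rtrancl)
  moreover have "verts (Sigma_graph n N) \<noteq> {}"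
    using assms(1) by auto
  ultimately show ?thesis
    unfolding connected_graph_def verts_bip_graph by blast
qed

lemma card_Sigma_lessThan:
  assumes "\<And>a. a < n \<Longrightarrow> N a \<subseteq> upper_part n"
  shows "card (Sigma {..<n} N) = (\<Sum>a<n. card (N a))"
proof (rule card_SigmaI)
  show "\<forall>a\<in>{..<n}. finite (N a)"
    using assms finite_subset by blast
qed simp

text \<open>The double star with centres \<open>0\<close> and \<open>n\<close> and
  \<open>n - 1\<close> leaves at each.\<close>

definition star_nbrs :: "nat \<Rightarrow> nat \<Rightarrow> nat set" where
  "star_nbrs n a = (if a = 0 then upper_part n else {n})"

lemma star_nbrs_subset: "a < n \<Longrightarrow> star_nbrs n a \<subseteq> upper_part n"
  by (auto simp: star_nbrs_def)

lemma card_star: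
  assumes "n > 0"
  shows "card (Sigma {..<n} (star_nbrs n)) = 2 * n - 1"
proof -
  obtain m where "n = Suc m"
    using assms gr0_implies_Suc by blast
  then show ?thesis
    unfolding card_Sigma_lessThan[OF star_nbrs_subset]
    by (simp add: star_nbrs_def sum.lessThan_Suc_shift del: sum.lessThan_Suc)
qed

lemma connected_star:
  assumes "n > 0"
  shows "connected_graph (Sigma_graph n (star_nbrs n))"
proof (rule connected_Sigma_graphI[OF assms])
  show up: "b \<in> reach n (star_nbrs n)" if "n \<le> b" "b < 2 * n" for b
    using reach_up[OF zero_reach assms, of b] that by (simp add: star_nbrs_def)
  show "a \<in> reach n (star_nbrs n)" if "a < n" for a
    using reach_down[OF up[of n] that] that by (simp add: star_nbrs_def)
qed

lemma star_path_graph5_free: "graph_free (path_graph 5) (Sigma_graph n (star_nbrs n))"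
  unfolding graph_free_iff[OF simple_path_graph]
proof
  assume "\<exists>f. inj_on f (verts (path_graph 5)) \<and>
    f ` verts (path_graph 5) \<subseteq> verts (Sigma_graph n (star_nbrs n)) \<and>
    (\<forall>e\<in>edges (path_graph 5). f ` e \<in> edges (Sigma_graph n (star_nbrs n)))"
  then obtain f where f: "inj_on f (verts (path_graph 5))"
    and e: "\<And>e. e \<in> edges (path_graph 5) \<Longrightarrow> f ` e \<in> edges (Sigma_graph n (star_nbrs n))"
    by blast
  have eq: "f i = f j \<longleftrightarrow> i = j" if "i < 5" "j < 5" for i j
    using inj_on_eq_iff[OF f, of i j] that by (simp add: path_graph_def)
  have adj: "{f i, f (Suc i)} \<in> edges (Sigma_graph n (star_nbrs n))" if "Suc i < 5" for i
    using e[of "{i, Suc i}"] that by (auto simp: path_graph_def)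
  \<comment> \<open>An inner vertex of a path has two distinct neighbours, which makes it one of the
    two centres. But \<open>P_5\<close> has three inner vertices.\<close>
  have inner: "x \<in> {0, n}"
    if "{y, x} \<in> edges (Sigma_graph n (star_nbrs n))" "{x, z} \<in> edges (Sigma_graph n (star_nbrs n))" "y \<noteq> z"
    for x y z
    using that by (auto simp: star_nbrs_def split: if_splits)
  have "f (Suc i) \<in> {0, n}" if "i < 3" for i
    using inner[OF adj[of i] adj[of "Suc i"]] eq[of i "Suc (Suc i)"] that by simp
  from this[of 0] this[of 1] this[of 2] show False
    using eq[of 1 2] eq[of 2 3] eq[of 1 3] by (auto simp: numeral_eq_Suc)
qed

text \<open>The cycle \<open>0\<close>, \<open>n\<close>, \<open>1\<close>, \<open>n + 1\<close>,
  and so on up to \<open>n - 1\<close>, \<open>2 * n - 1\<close> and back to \<open>0\<close>; the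
  case \<open>a = 0\<close> closes it.\<close>

definition cycle_nbrs :: "nat \<Rightarrow> nat \<Rightarrow> nat set" where
  "cycle_nbrs n a = {n + a, if a = 0 then 2 * n - 1 else n + a - 1}"

lemma cycle_nbrs_subset: "a < n \<Longrightarrow> cycle_nbrs n a \<subseteq> upper_part n"
  by (auto simp: cycle_nbrs_def)

lemma card_cycle:
  assumes "n \<ge> 2"
  shows "card (Sigma {..<n} (cycle_nbrs n)) = 2 * n"
proof -
  have "card (cycle_nbrs n a) = 2" if "a < n" for a
    using that assms by (auto simp: cycle_nbrs_def card_insert_if)
  then show ?thesis
    using card_Sigma_lessThan[of n "cycle_nbrs n", OF cycle_nbrs_subset] by simp
qed

lemma connected_cycle:
  assumes "n > 0"
  shows "connected_graph (Sigma_graph n (cycle_nbrs n))"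
proof (rule connected_Sigma_graphI[OF assms])
  show low: "a \<in> reach n (cycle_nbrs n)" if "a < n" for a
    using that
  proof (induction a)
    case 0
    show ?case by (rule zero_reach)
  next
    case (Suc a)
    have "n + a \<in> reach n (cycle_nbrs n)"
      by (rule reach_up[OF Suc.IH]) (use Suc.prems in \<open>auto simp: cycle_nbrs_def\<close>)
    then show ?case
      by (rule reach_down) (use Suc in \<open>auto simp: cycle_nbrs_def\<close>)
  qed
  show "b \<in> reach n (cycle_nbrs n)" if "n \<le> b" "b < 2 * n" for b
    by (rule reach_up[OF low[of "b - n"]]) (use that in \<open>auto simp: cycle_nbrs_def\<close>)
qed

lemma cycle_spider_free:
  assumes "length as = 3" "\<And>i. i < 3 \<Longrightarrow> as ! i > 0"
  shows "graph_free (spider as) (Sigma_graph n (cycle_nbrs n))"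
proof (rule disj_bip.spider_free_if_degree_le_2[OF disj_bip_Sigma[OF cycle_nbrs_subset] _ _ assms])
  show "card (Sigma {..<n} (cycle_nbrs n) `` {a}) \<le> 2" for a
    by (rule card_doubleton_le[of _ "n + a" "if a = 0 then 2 * n - 1 else n + a - 1"])
      (auto simp: cycle_nbrs_def)
  show "card ((Sigma {..<n} (cycle_nbrs n))\<inverse> `` {b}) \<le> 2" for b
  proof (rule card_doubleton_le)
    \<comment> \<open>These are the vertices before and after \<open>b\<close> on the cycle, where
      \<open>2 * n - 1\<close> is followed by \<open>0\<close>.\<close>
    show "(Sigma {..<n} (cycle_nbrs n))\<inverse> `` {b} \<subseteq> {b - n, if b = 2 * n - 1 then 0 else Suc b - n}"
    proof
      fix a assume "a \<in> (Sigma {..<n} (cycle_nbrs n))\<inverse> `` {b}"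
      then have "a < n" "b = n + a \<or> b = (if a = 0 then 2 * n - 1 else n + a - 1)"
        by (auto simp: cycle_nbrs_def)
      then have "a = b - n \<or> b = 2 * n - 1 \<and> a = 0 \<or> b \<noteq> 2 * n - 1 \<and> a = Suc b - n"
        by (cases "a = 0") (simp_all, linarith+)
      then show "a \<in> {b - n, if b = 2 * n - 1 then 0 else Suc b - n}"
        by auto
    qed
  qed
qed

text \<open>The big vertices are \<open>0\<close> and \<open>n\<close> in the first graph, which is optimal for
  \<open>3 \<le> n \<le> 5\<close>, and \<open>0\<close>, \<open>1\<close>, \<open>n\<close>, \<open>n + 1\<close> in the second, where the edge between \<open>2\<close> and
  \<open>n + 2\<close> joins what would otherwise be two components.\<close>

definition one_big_nbrs :: "nat \<Rightarrow> nat \<Rightarrow> nat set" where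
  "one_big_nbrs n a = (if a = 0 then {n<..<2 * n} else {n, n + a})"

lemma one_big_nbrs_subset: "a < n \<Longrightarrow> one_big_nbrs n a \<subseteq> upper_part n"
  by (auto simp: one_big_nbrs_def)

lemma card_one_big:
  assumes "n > 0"
  shows "card (Sigma {..<n} (one_big_nbrs n)) = 3 * (n - 1)"
proof -
  obtain m where "n = Suc m"
    using assms gr0_implies_Suc by blast
  then show ?thesis
    unfolding card_Sigma_lessThan[OF one_big_nbrs_subset]
    by (simp add: one_big_nbrs_def sum.lessThan_Suc_shift del: sum.lessThan_Suc)
qed

lemma connected_one_big:
  assumes "n > 1"
  shows "connected_graph (Sigma_graph n (one_big_nbrs n))"
proof (rule connected_Sigma_graphI)
  have up: "b \<in> reach n (one_big_nbrs n)" if "n < b" "b < 2 * n" for b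
    by (rule reach_up[OF zero_reach]) (use that in \<open>auto simp: one_big_nbrs_def\<close>)
  show low: "a \<in> reach n (one_big_nbrs n)" if "a < n" for a
  proof (cases "a = 0")
    case False
    then show ?thesis
      using reach_down[OF up[of "n + a"] that] that by (simp add: one_big_nbrs_def)
  qed (use zero_reach in simp)
  have "n \<in> reach n (one_big_nbrs n)"
    by (rule reach_up[OF low[of 1]]) (use assms in \<open>auto simp: one_big_nbrs_def\<close>)
  then show "b \<in> reach n (one_big_nbrs n)" if "n \<le> b" "b < 2 * n" for b
    using up that by (cases "b = n") auto
qed (use assms in simp)

lemma one_big_double_star_free:
  "graph_free (double_star 2 2) (Sigma_graph n (one_big_nbrs n))"
proof -
  let ?R = "Sigma {..<n} (one_big_nbrs n)"
  interpret disj_bip "{..<n}" "upper_part n" ?R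
    by (rule disj_bip_Sigma[OF one_big_nbrs_subset])
  have "card (?R `` {a}) \<le> 2 \<or> card (?R\<inverse> `` {b}) \<le> 2" if "(a, b) \<in> ?R" for a b
  proof (cases "a = 0")
    case True
    \<comment> \<open>An edge at \<open>0\<close> ends in some \<open>b > n\<close>, whose only
      other neighbour is \<open>b - n\<close>.\<close>
    with that have "?R\<inverse> `` {b} \<subseteq> {0, b - n}"
      by (auto simp: one_big_nbrs_def split: if_splits)
    then show ?thesis by (blast intro: card_doubleton_le)
  next
    case False
    then have "?R `` {a} \<subseteq> {n, n + a}"
      by (auto simp: one_big_nbrs_def)
    then show ?thesis by (blast intro: card_doubleton_le)
  qed
  then show ?thesis
    unfolding double_star_free_iff no_big_edge_def by blast
qed

definition two_big_nbrs :: "nat \<Rightarrow> nat \<Rightarrow> nat set" where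
  "two_big_nbrs n a = (if a = 0 then {n + 2..<2 * n} else if a = 1 then {n + 3..<2 * n}
     else if a = 2 then {n, n + 2} else {n, n + 1})"

lemma two_big_nbrs_subset: "n \<ge> 3 \<Longrightarrow> a < n \<Longrightarrow> two_big_nbrs n a \<subseteq> upper_part n"
  by (auto simp: two_big_nbrs_def)

text \<open>The vertices \<open>0\<close> and \<open>1\<close> have degrees \<open>n - 2\<close> and
  \<open>n - 3\<close>, and the other \<open>n - 2\<close> vertices below \<open>n\<close> have
  degree 2.\<close>

lemma card_two_big:
  assumes "n \<ge> 3"
  shows "card (Sigma {..<n} (two_big_nbrs n)) = 4 * n - 9"
proof -
  obtain m where "n = Suc (Suc (Suc m))"
    using assms by (metis numeral_3_eq_3 le_Suc_ex add_Suc add_0)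
  then show ?thesis
    unfolding card_Sigma_lessThan[OF two_big_nbrs_subset[OF assms]]
    by (simp add: two_big_nbrs_def sum.lessThan_Suc_shift del: sum.lessThan_Suc)
qed

text \<open>From \<open>n = 4\<close> on, the vertex \<open>1\<close> has a neighbour, namely
  \<open>n + 3\<close>. The walk from \<open>0\<close> reaches \<open>n\<close> through
  \<open>n + 2\<close> and \<open>2\<close>, then all \<open>a \<ge> 2\<close>, and
  \<open>n + 1\<close> through \<open>3\<close>.\<close>

lemma connected_two_big:
  assumes "n \<ge> 4"
  shows "connected_graph (Sigma_graph n (two_big_nbrs n))"
proof (rule connected_Sigma_graphI)
  have up: "b \<in> reach n (two_big_nbrs n)" if "n + 2 \<le> b" "b < 2 * n" for b
    by (rule reach_up[OF zero_reach]) (use that in \<open>auto simp: two_big_nbrs_def\<close>)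
  have r1: "1 \<in> reach n (two_big_nbrs n)"
    by (rule reach_down[OF up[of "n + 3"]]) (use assms in \<open>auto simp: two_big_nbrs_def\<close>)
  have r2: "2 \<in> reach n (two_big_nbrs n)"
    by (rule reach_down[OF up[of "n + 2"]]) (use assms in \<open>auto simp: two_big_nbrs_def\<close>)
  have rn: "n \<in> reach n (two_big_nbrs n)"
    by (rule reach_up[OF r2]) (use assms in \<open>auto simp: two_big_nbrs_def\<close>)
  show low: "a \<in> reach n (two_big_nbrs n)" if "a < n" for a
  proof -
    consider "a = 0" | "a = 1" | "a \<ge> 2" by linarith
    then show ?thesis
    proof cases
      case 3
      then show ?thesis
        using reach_down[OF rn that] by (auto simp: two_big_nbrs_def)
    qed (use zero_reach r1 in simp_all)
  qed
  have "n + 1 \<in> reach n (two_big_nbrs n)"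
    by (rule reach_up[OF low[of 3]]) (use assms in \<open>auto simp: two_big_nbrs_def\<close>)
  then show "b \<in> reach n (two_big_nbrs n)" if "n \<le> b" "b < 2 * n" for b
  proof -
    consider "b = n" | "b = n + 1" | "b \<ge> n + 2" using \<open>n \<le> b\<close> by linarith
    then show ?thesis
      by cases (use \<open>n + 1 \<in> _\<close> rn up that in simp_all)
  qed
qed (use assms in simp)

lemma two_big_double_star_free:
  assumes "n \<ge> 3"
  shows "graph_free (double_star 2 2) (Sigma_graph n (two_big_nbrs n))"
proof -
  let ?R = "Sigma {..<n} (two_big_nbrs n)"
  interpret disj_bip "{..<n}" "upper_part n" ?R
    by (rule disj_bip_Sigma[OF two_big_nbrs_subset[OF assms]])
  have "card (?R `` {a}) \<le> 2 \<or> card (?R\<inverse> `` {b}) \<le> 2" if "(a, b) \<in> ?R" for a b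
  proof (cases "a < 2")
    case True
    \<comment> \<open>Here \<open>b\<close> is either \<open>n + 2\<close>, with neighbours
      \<open>0\<close> and \<open>2\<close>, or larger, with neighbours \<open>0\<close> and
      \<open>1\<close>.\<close>
    with that have "?R\<inverse> `` {b} \<subseteq> {0, if b = n + 2 then 2 else 1}"
      by (auto simp: two_big_nbrs_def split: if_splits)
    then show ?thesis by (blast intro: card_doubleton_le)
  next
    case False
    then have "?R `` {a} \<subseteq> {n, if a = 2 then n + 2 else n + 1}"
      by (auto simp: two_big_nbrs_def split: if_splits)
    then show ?thesis by (blast intro: card_doubleton_le)
  qed
  then show ?thesis
    unfolding double_star_free_iff no_big_edge_def by blast
qed

section \<open>The extremal numbers\<close>

lemma ex_bc_path_graph:
  assumes "n \<ge> 3" "k = 5 \<or> k = 6"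
  shows "ex_bc n (path_graph k) = 2 * n - 1"
proof (rule ex_bc_eqI)
  fix A B :: "nat set" and R
  assume "disj_bip A B R" "conn_bip A B R" "card A = n" "card B = n"
    "graph_free (path_graph k) (bip_graph A B R)"
  then show "card R \<le> 2 * n - 1"
    using conn_bip.path6_free_card_le[of A B R] disj_bip.path_graph6_free_imp[of A B R]
      path_graph_free_mono[of k "bip_graph A B R" 6] assms by (simp add: mult_2) linarith
next
  show "disj_bip {..<n} (upper_part n) (Sigma {..<n} (star_nbrs n))"
    by (rule disj_bip_Sigma[OF star_nbrs_subset])
  show "graph_free (path_graph k) (Sigma_graph n (star_nbrs n))"
    by (rule path_graph_free_mono[OF star_path_graph5_free]) (use assms(2) in auto)
qed (use assms connected_star card_star in auto)

lemma ex_bc_double_star_large: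
  assumes "n \<ge> 6"
  shows "ex_bc n (double_star 2 2) = 4 * n - 9"
proof (rule ex_bc_eqI)
  fix A B :: "nat set" and R
  assume "disj_bip A B R" "conn_bip A B R" "card A = n" "card B = n"
    "graph_free (double_star 2 2) (bip_graph A B R)"
  then show "card R \<le> 4 * n - 9"
    using conn_bip.no_big_edge_conn_card_le disj_bip.double_star_free_iff assms by blast
next
  show "disj_bip {..<n} (upper_part n) (Sigma {..<n} (two_big_nbrs n))"
    by (rule disj_bip_Sigma[OF two_big_nbrs_subset]) (use assms in auto)
qed (use assms connected_two_big card_two_big two_big_double_star_free in auto)

text \<open>The bound covers all balanced bipartite graphs and is attained by a connected one, which
  is why \<open>ex_b\<close> and \<open>ex_bc\<close> agree for these \<open>n\<close>.\<close>

lemma double_star_free_card_le_small: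
  assumes "disj_bip A B R" "card A = n" "card B = n" "3 \<le> n" "n \<le> 5"
    "graph_free (double_star 2 2) (bip_graph A B R)"
  shows "card R \<le> 3 * (n - 1)"
  using bip.no_big_edge_card_le disj_bip.double_star_free_iff assms disj_bip.axioms(1) by blast

lemma ex_bc_double_star_small:
  assumes "3 \<le> n" "n \<le> 5"
  shows "ex_bc n (double_star 2 2) = 3 * (n - 1)"
proof (rule ex_bc_eqI)
  show "disj_bip {..<n} (upper_part n) (Sigma {..<n} (one_big_nbrs n))"
    by (rule disj_bip_Sigma[OF one_big_nbrs_subset])
qed (use assms double_star_free_card_le_small connected_one_big card_one_big
    one_big_double_star_free in auto)

lemma ex_b_double_star_small:
  assumes "3 \<le> n" "n \<le> 5"
  shows "ex_b n (double_star 2 2) = 3 * (n - 1)"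
proof (rule ex_b_eqI)
  show "disj_bip {..<n} (upper_part n) (Sigma {..<n} (one_big_nbrs n))"
    by (rule disj_bip_Sigma[OF one_big_nbrs_subset])
qed (use assms double_star_free_card_le_small card_one_big one_big_double_star_free in auto)

lemma ex_bc_spider311:
  assumes "n \<ge> 4"
  shows "ex_bc n (spider [3, 1, 1]) = 2 * n"
proof (rule ex_bc_eqI)
  fix A B :: "nat set" and R
  assume "disj_bip A B R" "conn_bip A B R" "card A = n" "card B = n"
    "graph_free (spider [3, 1, 1]) (bip_graph A B R)"
  then show "card R \<le> 2 * n"
    using conn_bip.spider311_free_card_le disj_bip.spider311_free_imp assms by blast
next
  show "disj_bip {..<n} (upper_part n) (Sigma {..<n} (cycle_nbrs n))"
    by (rule disj_bip_Sigma[OF cycle_nbrs_subset])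
  show "graph_free (spider [3, 1, 1]) (Sigma_graph n (cycle_nbrs n))"
    by (rule cycle_spider_free) (auto simp: less_Suc_eq numeral_3_eq_3)
qed (use assms connected_cycle card_cycle in auto)

lemma (in disj_bip) bip_graph_converse: "bip_graph B A (R\<inverse>) = bip_graph A B R"
  by (force simp: bip_graph_def)

lemma (in disj_bip) disj_bip_converse: "disj_bip B A (R\<inverse>)"
  using bip_converse disj by (simp add: disj_bip_def disj_bip_axioms_def Int_commute)

lemma ex_bc_spider221:
  assumes "n \<ge> 3"
  shows "ex_bc n (spider [2, 2, 1]) = 2 * n"
proof (rule ex_bc_eqI)
  fix A B :: "nat set" and R
  assume db: "disj_bip A B R" and cb: "conn_bip A B R" and n: "card A = n" "card B = n"
    and free: "graph_free (spider [2, 2, 1]) (bip_graph A B R)"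
  have "spider221_free R" "spider221_free (R\<inverse>)"
    using disj_bip.spider221_free_imp db disj_bip.disj_bip_converse free disj_bip.bip_graph_converse
    by metis+
  then have "card R + card {a \<in> A. card (R `` {a}) = 1} \<le> 2 * n + card {b \<in> B. card (R\<inverse> `` {b}) = 1}"
    "card R + card {b \<in> B. card (R\<inverse> `` {b}) = 1} \<le> 2 * n + card {a \<in> A. card (R `` {a}) = 1}"
    using conn_bip.spider221_free_sum_le[OF cb] n assms
      conn_bip.spider221_free_sum_le[OF conn_bip.conn_bip_converse[OF cb]] by simp_all
  \<comment> \<open>Adding the two inequalities cancels the leaf counts and gives
    \<open>2 * card R \<le> 4 * n\<close>.\<close>
  then show "card R \<le> 2 * n"
    by linarith
next
  show "disj_bip {..<n} (upper_part n) (Sigma {..<n} (cycle_nbrs n))"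
    by (rule disj_bip_Sigma[OF cycle_nbrs_subset])
  show "graph_free (spider [2, 2, 1]) (Sigma_graph n (cycle_nbrs n))"
    by (rule cycle_spider_free) (auto simp: less_Suc_eq numeral_3_eq_3)
qed (use assms connected_cycle card_cycle in auto)

theorem theorem7:
  shows "(\<forall>n\<ge>3. ex_bc n (path_graph 5) = 2 * n - 1 \<and> ex_bc n (path_graph 6) = 2 * n - 1) \<and>
    ((\<forall>n\<ge>6. ex_bc n (double_star 2 2) = 4 * n - 9) \<and>
     (\<forall>n. 3 \<le> n \<and> n \<le> 5 \<longrightarrow> ex_bc n (double_star 2 2) = ex_b n (double_star 2 2))) \<and>
    (\<forall>n\<ge>4. ex_bc n (spider [3, 1, 1]) = 2 * n) \<and>
    (\<forall>n\<ge>3. ex_bc n (spider [2, 2, 1]) = 2 * n)"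
  using ex_bc_path_graph ex_bc_double_star_large ex_bc_double_star_small ex_b_double_star_small
    ex_bc_spider311 ex_bc_spider221 by simp

end
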